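(* Let $\langle i_X:\mathcal M X\to\mathcal P X\leftarrow\mathcal M'X:i'_X;\ X\in\mathcal C\rangle$ be a temporal doctrine and $f:X\to Y$ a map in $\mathcal C$. If $f$ is final, that is $\exists_f\top_X\cong\top_Y$, then for $M\in\mathcal M Y$ and $N\in\mathcal M'Y$ $$\underline{\rm lim}_X(f\cdot M)\cong\underline{\rm lim}_YM,\qquad \underline{\rm colim}'_X(f'\cdot N)\cong\underline{\rm colim}'_YN.$$ Dually, if $f$ is initial, that is $\exists'_f\top'_X\cong\top'_Y$, then $$\underline{\rm colim}_X(f\cdot M)\cong\underline{\rm colim}_YM,\qquad \underline{\rm lim}'_X(f'\cdot N)\cong\underline{\rm lim}'_YN.$$
   Context: A temporal doctrine $\langle i_X:\mathcal M X\to\mathcal P X\leftarrow\mathcal M'X:i'_X;\ X\in\mathcal C\rangle$ consists of a category $\mathcal C$, three $\mathcal C$-indexed categories $\mathcal M,\mathcal P,\mathcal M'$ (pseudofunctors $\mathcal C^{op}\to\mathbf{Cat}$), and two indexed functors $i:\mathcal M\to\mathcal P$, $i':\mathcal M'\to\mathcal P$. The substitution functors along $f:X\to Y$ are written $f\cdot(-):\mathcal M Y\to\mathcal M X$, $f'\cdot(-):\mathcal M'Y\to\mathcal M'X$, $f^*:\mathcal P Y\to\mathcal P X$; thus $i_X(f\cdot M)\cong f^*i_Y M$ and $i'_X(f'\cdot N)\cong f^*i'_Y N$, coherently. $\mathcal B X:=\mathcal M X\times_{\mathcal P X}\mathcal M'X$ denotes the indexed pullback of $i$ and $i'$ (equalities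 up to the coherent isomorphisms), with projections $j_X:\mathcal B X\to\mathcal M X$, $j'_X:\mathcal B X\to\mathcal M'X$, and $b_X:=i_Xj_X=i'_Xj'_X:\mathcal B X\to\mathcal P X$. The axioms are: (A1) $\mathcal C$ has a terminal object $1$. (A2) Each $\mathcal P X$ is cartesian closed, with terminal object $1_X$, products $P\times_X Q$ and exponentials $P\Rightarrow Q$. (A3) Each $f^*$ has left and right adjoints $\Sigma_f\dashv f^*\dashv\Pi_f$. (A4) $i_X$ and $i'_X$ have left and right adjoints: $\Diamond_X\dashv i_X\dashv\Box_X$, $\Diamond'_X\dashv i'_X\dashv\Box'_X$. (A5) (comprehension) The canonical functor $c_X:\mathcal C/X\to\mathcal P X$, sending $f:T\to X$ to $\Sigma_f1_T$, has a right adjoint $k_X:\mathcal P X\to\mathcal C/X$. (B1) $i_X$ and $i'_X$ are fully faithful. (B2) (Frobenius law) $\Sigma_fP\times_YQ\cong\Sigma_f(P\times_Xf^*Q)$ canonically, naturally in $P\in\mathcal P X$, $Q\in\mathcal P Y$, for every $f:X\to Y$. (B3) (mixed Frobenius laws) The units of $\Diamond_X\dashv i_X$ and $\Diamond'_X\dashv i'_X$ induce isomorphisms $\Diamond_X(P\times_Xi'_XN)\cong\Diamond_X(i_X\Diamond_XP\times_Xi'_XN)$ and $\Diamond'_X(P\times_Xi_XM)\cong\Diamond'_X(i'_X\Diamond'_XP\times_Xi_XM)$, natural in $P\in\mathcal P X$, $M\in\mathcal M X$, $N\in\mathcal M'X$. (B4) $j_1:\mathcal B1\to\mathcal M1$ and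 $j'_1:\mathcal B1\to\mathcal M'1$ are isomorphisms. (B5) Each $k_X$ is fully faithful. Derived notation. $\top_X$ and $\top'_X$ are the terminal objects of $\mathcal M X$ and $\mathcal M'X$. For $f:X\to Y$, $f\cdot(-)$ has left adjoint $\exists_f:=\Diamond_Y\Sigma_fi_X$ and right adjoint $\forall_f:=\Box_Y\Pi_fi_X$, and $f'\cdot(-)$ has left adjoint $\exists'_f:=\Diamond'_Y\Sigma_fi'_X$ and right adjoint $\forall'_f:=\Box'_Y\Pi_fi'_X$. An object $X$ used as an index of a quantifier denotes the map $X\to1$. The functor $X^*b_1:\mathcal B1\to\mathcal P X$ has a left adjoint $\underline{\rm coend}_X$ and a right adjoint $\underline{\rm end}_X$. The limit and colimit functors, with values in $\mathcal B1$, are $\underline{\rm lim}_X:=\underline{\rm end}_Xi_X\cong j_1^{-1}\forall_X$ and $\underline{\rm colim}_X:=\underline{\rm coend}_Xi_X\cong j_1^{-1}\exists_X$ on $\mathcal M X$; $\underline{\rm lim}'_X:=\underline{\rm end}_Xi'_X\cong {j'_1}^{-1}\forall'_X$ and $\underline{\rm colim}'_X:=\underline{\rm coend}_Xi'_X\cong {j'_1}^{-1}\exists'_X$ on $\mathcal M'X$. *)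

theory Defs
  imports Main
begin

section \<open>Categories, functors, natural transformations\<close>

record ('o, 'a) cat =
  Ob :: "'o set"
  Ar :: "'a set"
  src :: "'a \<Rightarrow> 'o"
  tgt :: "'a \<Rightarrow> 'o"
  idt :: "'o \<Rightarrow> 'a"
  cmp :: "'a \<Rightarrow> 'a \<Rightarrow> 'a"  (infixr "\<cdot>\<index>" 70)

definition hom :: "('o, 'a) cat \<Rightarrow> 'o \<Rightarrow> 'o \<Rightarrow> 'a set" where
  "hom A x y = {a \<in> Ar A. src A a = x \<and> tgt A a = y}"

text \<open>\<open>g \<cdot>\<^bsub>A\<^esub> f\<close> is \<open>g\<close> after \<open>f\<close>.\<close>

locale category =
  fixes A :: "('o, 'a) cat"
  assumes src_in: "a \<in> Ar A \<Longrightarrow> src A a \<in> Ob A"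
    and tgt_in: "a \<in> Ar A \<Longrightarrow> tgt A a \<in> Ob A"
    and idt_in: "x \<in> Ob A \<Longrightarrow> idt A x \<in> hom A x x"
    and cmp_in: "f \<in> hom A x y \<Longrightarrow> g \<in> hom A y z \<Longrightarrow> g \<cdot>\<^bsub>A\<^esub> f \<in> hom A x z"
    and cmp_idt: "f \<in> hom A x y \<Longrightarrow> f \<cdot>\<^bsub>A\<^esub> idt A x = f"
    and idt_cmp: "f \<in> hom A x y \<Longrightarrow> idt A y \<cdot>\<^bsub>A\<^esub> f = f"
    and cmp_assoc: "f \<in> hom A w x \<Longrightarrow> g \<in> hom A x y \<Longrightarrow> h \<in> hom A y z \<Longrightarrow>
      (h \<cdot>\<^bsub>A\<^esub> g) \<cdot>\<^bsub>A\<^esub> f = h \<cdot>\<^bsub>A\<^esub> (g \<cdot>\<^bsub>A\<^esub> f)"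

definition is_inverse :: "('o, 'a) cat \<Rightarrow> 'a \<Rightarrow> 'a \<Rightarrow> bool" where
  "is_inverse A a b \<longleftrightarrow> a \<in> Ar A \<and> b \<in> hom A (tgt A a) (src A a) \<and>
     b \<cdot>\<^bsub>A\<^esub> a = idt A (src A a) \<and> a \<cdot>\<^bsub>A\<^esub> b = idt A (tgt A a)"

definition is_iso :: "('o, 'a) cat \<Rightarrow> 'a \<Rightarrow> bool" where
  "is_iso A a \<longleftrightarrow> (\<exists>b. is_inverse A a b)"

definition inverse_arr :: "('o, 'a) cat \<Rightarrow> 'a \<Rightarrow> 'a" where
  "inverse_arr A a = (THE b. is_inverse A a b)"

definition isomorphic :: "('o, 'a) cat \<Rightarrow> 'o \<Rightarrow> 'o \<Rightarrow> bool" where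
  "isomorphic A x y \<longleftrightarrow> (\<exists>a \<in> hom A x y. is_iso A a)"

record ('o, 'a, 'p, 'b) ftor =
  fo :: "'o \<Rightarrow> 'p"
  fa :: "'a \<Rightarrow> 'b"

locale is_functor = dom: category A + cod: category B
  for A :: "('o, 'a) cat" and B :: "('p, 'b) cat" +
  fixes F :: "('o, 'a, 'p, 'b) ftor"
  assumes fo_in: "x \<in> Ob A \<Longrightarrow> fo F x \<in> Ob B"
    and fa_in: "a \<in> hom A x y \<Longrightarrow> fa F a \<in> hom B (fo F x) (fo F y)"
    and fa_idt: "x \<in> Ob A \<Longrightarrow> fa F (idt A x) = idt B (fo F x)"
    and fa_cmp: "a \<in> hom A x y \<Longrightarrow> b \<in> hom A y z \<Longrightarrow>
      fa F (b \<cdot>\<^bsub>A\<^esub> a) = fa F b \<cdot>\<^bsub>B\<^esub> fa F a"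

definition id_ftor :: "('o, 'a, 'o, 'a) ftor" where
  "id_ftor = \<lparr>fo = \<lambda>x. x, fa = \<lambda>a. a\<rparr>"

definition cmp_ftor :: "('p, 'b, 'q, 'c) ftor \<Rightarrow> ('o, 'a, 'p, 'b) ftor \<Rightarrow> ('o, 'a, 'q, 'c) ftor"
    (infixr "\<odot>" 70) where
  "G \<odot> F = \<lparr>fo = \<lambda>x. fo G (fo F x), fa = \<lambda>a. fa G (fa F a)\<rparr>"

definition fully_faithful ::
    "('o, 'a) cat \<Rightarrow> ('p, 'b) cat \<Rightarrow> ('o, 'a, 'p, 'b) ftor \<Rightarrow> bool" where
  "fully_faithful A B F \<longleftrightarrow> is_functor A B F \<and>
     (\<forall>x \<in> Ob A. \<forall>y \<in> Ob A. bij_betw (fa F) (hom A x y) (hom B (fo F x) (fo F y)))"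

locale nat_trans = F: is_functor A B F + G: is_functor A B G
  for A :: "('o, 'a) cat" and B :: "('p, 'b) cat" and F G :: "('o, 'a, 'p, 'b) ftor" +
  fixes t :: "'o \<Rightarrow> 'b"
  assumes component_in: "x \<in> Ob A \<Longrightarrow> t x \<in> hom B (fo F x) (fo G x)"
    and natural: "a \<in> hom A x y \<Longrightarrow> t y \<cdot>\<^bsub>B\<^esub> fa F a = fa G a \<cdot>\<^bsub>B\<^esub> t x"

locale nat_iso = nat_trans +
  assumes component_iso: "x \<in> Ob A \<Longrightarrow> is_iso B (t x)"

definition nat_isomorphic ::
    "('o, 'a) cat \<Rightarrow> ('p, 'b) cat \<Rightarrow> ('o, 'a, 'p, 'b) ftor \<Rightarrow> ('o, 'a, 'p, 'b) ftor \<Rightarrow> bool" where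
  "nat_isomorphic A B F G \<longleftrightarrow> (\<exists>t. nat_iso A B F G t)"

definition is_equivalence ::
    "('o, 'a) cat \<Rightarrow> ('p, 'b) cat \<Rightarrow> ('o, 'a, 'p, 'b) ftor \<Rightarrow> bool" where
  "is_equivalence A B F \<longleftrightarrow> is_functor A B F \<and>
     (\<exists>G. is_functor B A G \<and> nat_isomorphic A A (G \<odot> F) id_ftor \<and>
          nat_isomorphic B B (F \<odot> G) id_ftor)"


section \<open>Adjunctions\<close>

record ('o, 'a, 'p, 'b) adj =
  ladj :: "('o, 'a, 'p, 'b) ftor"
  radj :: "('p, 'b, 'o, 'a) ftor"
  unit :: "'o \<Rightarrow> 'a"
  counit :: "'p \<Rightarrow> 'b"

locale adjunction =
  L: is_functor A B "ladj J" + R: is_functor B A "radj J" +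
  unit: nat_trans A A id_ftor "radj J \<odot> ladj J" "unit J" +
  counit: nat_trans B B "ladj J \<odot> radj J" id_ftor "counit J"
  for A :: "('o, 'a) cat" and B :: "('p, 'b) cat" and J :: "('o, 'a, 'p, 'b) adj" +
  assumes triangle_left: "x \<in> Ob A \<Longrightarrow>
      counit J (fo (ladj J) x) \<cdot>\<^bsub>B\<^esub> fa (ladj J) (unit J x) = idt B (fo (ladj J) x)"
    and triangle_right: "y \<in> Ob B \<Longrightarrow>
      fa (radj J) (counit J y) \<cdot>\<^bsub>A\<^esub> unit J (fo (radj J) y) = idt A (fo (radj J) y)"

text \<open>Adjoints, terminal objects and products are given by their existence; since they are
  unique up to isomorphism, notation for "the" adjoint etc. denotes a fixed choice.\<close>

definition has_left_adjoint ::
    "('o, 'a) cat \<Rightarrow> ('p, 'b) cat \<Rightarrow> ('p, 'b, 'o, 'a) ftor \<Rightarrow> bool" where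
  "has_left_adjoint A B G \<longleftrightarrow> (\<exists>J. adjunction A B J \<and> radj J = G)"

definition has_right_adjoint ::
    "('o, 'a) cat \<Rightarrow> ('p, 'b) cat \<Rightarrow> ('o, 'a, 'p, 'b) ftor \<Rightarrow> bool" where
  "has_right_adjoint A B F \<longleftrightarrow> (\<exists>J. adjunction A B J \<and> ladj J = F)"

definition left_adjunction ::
    "('o, 'a) cat \<Rightarrow> ('p, 'b) cat \<Rightarrow> ('p, 'b, 'o, 'a) ftor \<Rightarrow> ('o, 'a, 'p, 'b) adj" where
  "left_adjunction A B G = (SOME J. adjunction A B J \<and> radj J = G)"

definition right_adjunction ::
    "('o, 'a) cat \<Rightarrow> ('p, 'b) cat \<Rightarrow> ('o, 'a, 'p, 'b) ftor \<Rightarrow> ('o, 'a, 'p, 'b) adj" where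
  "right_adjunction A B F = (SOME J. adjunction A B J \<and> ladj J = F)"

definition left_transpose ::
    "('p, 'b) cat \<Rightarrow> ('o, 'a, 'p, 'b) adj \<Rightarrow> 'p \<Rightarrow> 'a \<Rightarrow> 'b" where
  "left_transpose B J y u = counit J y \<cdot>\<^bsub>B\<^esub> fa (ladj J) u"


section \<open>Cartesian closed categories\<close>

definition is_terminal :: "('o, 'a) cat \<Rightarrow> 'o \<Rightarrow> bool" where
  "is_terminal A t \<longleftrightarrow> t \<in> Ob A \<and> (\<forall>x \<in> Ob A. \<exists>!a. a \<in> hom A x t)"

definition terminal :: "('o, 'a) cat \<Rightarrow> 'o" where
  "terminal A = (SOME t. is_terminal A t)"

definition to_terminal :: "('o, 'a) cat \<Rightarrow> 'o \<Rightarrow> 'a" where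
  "to_terminal A x = (THE a. a \<in> hom A x (terminal A))"

definition is_product :: "('o, 'a) cat \<Rightarrow> 'o \<Rightarrow> 'o \<Rightarrow> 'o \<times> 'a \<times> 'a \<Rightarrow> bool" where
  "is_product A p q = (\<lambda>(r, u, v). r \<in> Ob A \<and> u \<in> hom A r p \<and> v \<in> hom A r q \<and>
     (\<forall>x \<in> Ob A. \<forall>a \<in> hom A x p. \<forall>b \<in> hom A x q.
        \<exists>!w. w \<in> hom A x r \<and> u \<cdot>\<^bsub>A\<^esub> w = a \<and> v \<cdot>\<^bsub>A\<^esub> w = b))"

definition product :: "('o, 'a) cat \<Rightarrow> 'o \<Rightarrow> 'o \<Rightarrow> 'o \<times> 'a \<times> 'a" where
  "product A p q = (SOME c. is_product A p q c)"

definition prd :: "('o, 'a) cat \<Rightarrow> 'o \<Rightarrow> 'o \<Rightarrow> 'o" where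
  "prd A p q = fst (product A p q)"

definition pr1 :: "('o, 'a) cat \<Rightarrow> 'o \<Rightarrow> 'o \<Rightarrow> 'a" where
  "pr1 A p q = fst (snd (product A p q))"

definition pr2 :: "('o, 'a) cat \<Rightarrow> 'o \<Rightarrow> 'o \<Rightarrow> 'a" where
  "pr2 A p q = snd (snd (product A p q))"

definition pairing :: "('o, 'a) cat \<Rightarrow> 'a \<Rightarrow> 'a \<Rightarrow> 'a" where
  "pairing A a b = (THE w. w \<in> hom A (src A a) (prd A (tgt A a) (tgt A b)) \<and>
     pr1 A (tgt A a) (tgt A b) \<cdot>\<^bsub>A\<^esub> w = a \<and> pr2 A (tgt A a) (tgt A b) \<cdot>\<^bsub>A\<^esub> w = b)"

definition prd_arr :: "('o, 'a) cat \<Rightarrow> 'a \<Rightarrow> 'a \<Rightarrow> 'a" where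
  "prd_arr A a b = pairing A (a \<cdot>\<^bsub>A\<^esub> pr1 A (src A a) (src A b)) (b \<cdot>\<^bsub>A\<^esub> pr2 A (src A a) (src A b))"

definition is_exponential :: "('o, 'a) cat \<Rightarrow> 'o \<Rightarrow> 'o \<Rightarrow> 'o \<Rightarrow> 'a \<Rightarrow> bool" where
  "is_exponential A p q e ev \<longleftrightarrow> e \<in> Ob A \<and> ev \<in> hom A (prd A e p) q \<and>
     (\<forall>r \<in> Ob A. \<forall>u \<in> hom A (prd A r p) q.
        \<exists>!v. v \<in> hom A r e \<and> ev \<cdot>\<^bsub>A\<^esub> prd_arr A v (idt A p) = u)"

locale cartesian_closed = category +
  assumes has_terminal: "\<exists>t. is_terminal A t"
    and has_product: "p \<in> Ob A \<Longrightarrow> q \<in> Ob A \<Longrightarrow> \<exists>c. is_product A p q c"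
    and has_exponential: "p \<in> Ob A \<Longrightarrow> q \<in> Ob A \<Longrightarrow> \<exists>e ev. is_exponential A p q e ev"


section \<open>Slices and pullbacks of categories\<close>

definition slice :: "('o, 'a) cat \<Rightarrow> 'o \<Rightarrow> ('a, 'a \<times> 'a \<times> 'a) cat" where
  "slice A x =
    \<lparr>Ob = {f \<in> Ar A. tgt A f = x},
     Ar = {(f, h, g). f \<in> Ar A \<and> tgt A f = x \<and> g \<in> Ar A \<and> tgt A g = x \<and>
             h \<in> hom A (src A f) (src A g) \<and> g \<cdot>\<^bsub>A\<^esub> h = f},
     src = (\<lambda>(f, h, g). f),
     tgt = (\<lambda>(f, h, g). g),
     idt = (\<lambda>f. (f, idt A (src A f), f)),
     cmp = (\<lambda>(f', h', g') (f, h, g). (f, h' \<cdot>\<^bsub>A\<^esub> h, g'))\<rparr>"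

text \<open>The pullback of two functors with common codomain, where the square commutes up to
  a specified isomorphism: objects are triples \<open>(x, y, \<phi>)\<close> with \<open>\<phi> : F x \<cong> G y\<close>, arrows are
  pairs of arrows compatible with these isomorphisms.  A strict pullback would not be stable
  under the substitution functors of indexed categories.\<close>

type_synonym ('x, 'y, 'c) pb_ob = "'x \<times> 'y \<times> 'c"
type_synonym ('x, 'a, 'y, 'b, 'c) pb_ar =
  "('x, 'y, 'c) pb_ob \<times> ('a \<times> 'b) \<times> ('x, 'y, 'c) pb_ob"

definition pullback ::
    "('x, 'a) cat \<Rightarrow> ('y, 'b) cat \<Rightarrow> ('z, 'c) cat \<Rightarrow> ('x, 'a, 'z, 'c) ftor \<Rightarrow> ('y, 'b, 'z, 'c) ftor \<Rightarrow>
     (('x, 'y, 'c) pb_ob, ('x, 'a, 'y, 'b, 'c) pb_ar) cat" where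
  "pullback A B Z F G =
    (let obs = {(x, y, \<phi>). x \<in> Ob A \<and> y \<in> Ob B \<and> \<phi> \<in> hom Z (fo F x) (fo G y) \<and> is_iso Z \<phi>} in
    \<lparr>Ob = obs,
     Ar = {((x, y, \<phi>), (a, b), (x', y', \<phi>')).
             (x, y, \<phi>) \<in> obs \<and> (x', y', \<phi>') \<in> obs \<and> a \<in> hom A x x' \<and> b \<in> hom B y y' \<and>
             fa G b \<cdot>\<^bsub>Z\<^esub> \<phi> = \<phi>' \<cdot>\<^bsub>Z\<^esub> fa F a},
     src = (\<lambda>(s, ab, t). s),
     tgt = (\<lambda>(s, ab, t). t),
     idt = (\<lambda>(x, y, \<phi>). ((x, y, \<phi>), (idt A x, idt B y), (x, y, \<phi>))),
     cmp = (\<lambda>(s', (a', b'), t') (s, (a, b), t). (s, (a' \<cdot>\<^bsub>A\<^esub> a, b' \<cdot>\<^bsub>B\<^esub> b), t'))\<rparr>)"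

definition pb_fst :: "(('x, 'y, 'c) pb_ob, ('x, 'a, 'y, 'b, 'c) pb_ar, 'x, 'a) ftor" where
  "pb_fst = \<lparr>fo = \<lambda>(x, y, \<phi>). x, fa = \<lambda>(s, (a, b), t). a\<rparr>"

definition pb_snd :: "(('x, 'y, 'c) pb_ob, ('x, 'a, 'y, 'b, 'c) pb_ar, 'y, 'b) ftor" where
  "pb_snd = \<lparr>fo = \<lambda>(x, y, \<phi>). y, fa = \<lambda>(s, (a, b), t). b\<rparr>"


section \<open>Indexed categories and indexed functors\<close>

text \<open>For \<open>f : X \<rightarrow> Y\<close> and \<open>g : Y \<rightarrow> Z\<close>, \<open>sub\<close> is substitution, \<open>scmp f g p : f\<^sup>* g\<^sup>* p \<rightarrow> (g f)\<^sup>* p\<close>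
  and \<open>sid X p : p \<rightarrow> id\<^sub>X\<^sup>* p\<close> are the structural isomorphisms of a pseudofunctor.
  All fibres share one type of objects and one type of arrows; this is no restriction, as
  the carriers \<open>Ob\<close> and \<open>Ar\<close> depend on the index.\<close>

record ('o, 'a, 'p, 'b) icat =
  fib :: "'o \<Rightarrow> ('p, 'b) cat"
  sub :: "'a \<Rightarrow> ('p, 'b, 'p, 'b) ftor"
  scmp :: "'a \<Rightarrow> 'a \<Rightarrow> 'p \<Rightarrow> 'b"
  sid :: "'o \<Rightarrow> 'p \<Rightarrow> 'b"

locale indexed_category = base: category C
  for C :: "('o, 'a) cat" +
  fixes P :: "('o, 'a, 'p, 'b) icat"
  assumes fib_category: "X \<in> Ob C \<Longrightarrow> category (fib P X)"
    and sub_functor: "f \<in> hom C X Y \<Longrightarrow> is_functor (fib P Y) (fib P X) (sub P f)"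
    and scmp_iso: "f \<in> hom C X Y \<Longrightarrow> g \<in> hom C Y Z \<Longrightarrow>
      nat_iso (fib P Z) (fib P X) (sub P f \<odot> sub P g) (sub P (g \<cdot>\<^bsub>C\<^esub> f)) (scmp P f g)"
    and sid_iso: "X \<in> Ob C \<Longrightarrow> nat_iso (fib P X) (fib P X) id_ftor (sub P (idt C X)) (sid P X)"
    and scmp_sid_left: "f \<in> hom C X Y \<Longrightarrow> p \<in> Ob (fib P Y) \<Longrightarrow>
      scmp P (idt C X) f p \<cdot>\<^bsub>fib P X\<^esub> sid P X (fo (sub P f) p) = idt (fib P X) (fo (sub P f) p)"
    and scmp_sid_right: "f \<in> hom C X Y \<Longrightarrow> p \<in> Ob (fib P Y) \<Longrightarrow>
      scmp P f (idt C Y) p \<cdot>\<^bsub>fib P X\<^esub> fa (sub P f) (sid P Y p) = idt (fib P X) (fo (sub P f) p)"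
    and scmp_assoc: "f \<in> hom C X Y \<Longrightarrow> g \<in> hom C Y Z \<Longrightarrow> h \<in> hom C Z W \<Longrightarrow> p \<in> Ob (fib P W) \<Longrightarrow>
      scmp P (g \<cdot>\<^bsub>C\<^esub> f) h p \<cdot>\<^bsub>fib P X\<^esub> scmp P f g (fo (sub P h) p) =
      scmp P f (h \<cdot>\<^bsub>C\<^esub> g) p \<cdot>\<^bsub>fib P X\<^esub> fa (sub P f) (scmp P g h p)"

text \<open>\<open>cell f m\<close> is the structural isomorphism \<open>i\<^sub>X (f \<cdot> m) \<cong> f\<^sup>* (i\<^sub>Y m)\<close> for \<open>f : X \<rightarrow> Y\<close>.\<close>

record ('o, 'a, 'm, 'c, 'p, 'b) iftor =
  fn :: "'o \<Rightarrow> ('m, 'c, 'p, 'b) ftor"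
  cell :: "'a \<Rightarrow> 'm \<Rightarrow> 'b"

locale indexed_functor = dom: indexed_category C M + cod: indexed_category C P
  for C :: "('o, 'a) cat" and M :: "('o, 'a, 'm, 'c) icat" and P :: "('o, 'a, 'p, 'b) icat" +
  fixes i :: "('o, 'a, 'm, 'c, 'p, 'b) iftor"
  assumes fn_functor: "X \<in> Ob C \<Longrightarrow> is_functor (fib M X) (fib P X) (fn i X)"
    and cell_iso: "f \<in> hom C X Y \<Longrightarrow>
      nat_iso (fib M Y) (fib P X) (fn i X \<odot> sub M f) (sub P f \<odot> fn i Y) (cell i f)"
    and cell_sid: "X \<in> Ob C \<Longrightarrow> m \<in> Ob (fib M X) \<Longrightarrow>
      cell i (idt C X) m \<cdot>\<^bsub>fib P X\<^esub> fa (fn i X) (sid M X m) = sid P X (fo (fn i X) m)"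
    and cell_scmp: "f \<in> hom C X Y \<Longrightarrow> g \<in> hom C Y Z \<Longrightarrow> m \<in> Ob (fib M Z) \<Longrightarrow>
      cell i (g \<cdot>\<^bsub>C\<^esub> f) m \<cdot>\<^bsub>fib P X\<^esub> fa (fn i X) (scmp M f g m) =
      scmp P f g (fo (fn i Z) m) \<cdot>\<^bsub>fib P X\<^esub>
        (fa (sub P f) (cell i g m) \<cdot>\<^bsub>fib P X\<^esub> cell i f (fo (sub M g) m))"


section \<open>Temporal doctrines\<close>

record ('o, 'a, 'm, 'c, 'p, 'b, 'n, 'd) doctrine =
  CC :: "('o, 'a) cat"
  MM :: "('o, 'a, 'm, 'c) icat"
  PP :: "('o, 'a, 'p, 'b) icat"
  MM' :: "('o, 'a, 'n, 'd) icat"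
  ii :: "('o, 'a, 'm, 'c, 'p, 'b) iftor"
  ii' :: "('o, 'a, 'n, 'd, 'p, 'b) iftor"

text \<open>The adjunctions \<open>\<Sigma>\<^sub>f \<stileturn> f\<^sup>* \<stileturn> \<Pi>\<^sub>f\<close>, \<open>\<diamond>\<^sub>X \<stileturn> i\<^sub>X\<close>, \<open>\<diamond>'\<^sub>X \<stileturn> i'\<^sub>X\<close>.\<close>

definition Sigma_adj ::
    "('o, 'a, 'm, 'c, 'p, 'b, 'n, 'd) doctrine \<Rightarrow> 'a \<Rightarrow> ('p, 'b, 'p, 'b) adj" where
  "Sigma_adj D f =
     left_adjunction (fib (PP D) (src (CC D) f)) (fib (PP D) (tgt (CC D) f)) (sub (PP D) f)"

definition Dia_adj ::
    "('o, 'a, 'm, 'c, 'p, 'b, 'n, 'd) doctrine \<Rightarrow> 'o \<Rightarrow> ('p, 'b, 'm, 'c) adj" where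
  "Dia_adj D X = left_adjunction (fib (PP D) X) (fib (MM D) X) (fn (ii D) X)"

definition Dia'_adj ::
    "('o, 'a, 'm, 'c, 'p, 'b, 'n, 'd) doctrine \<Rightarrow> 'o \<Rightarrow> ('p, 'b, 'n, 'd) adj" where
  "Dia'_adj D X = left_adjunction (fib (PP D) X) (fib (MM' D) X) (fn (ii' D) X)"

text \<open>The functor \<open>c\<^sub>X : C/X \<rightarrow> P X\<close>.  An arrow \<open>h : f \<rightarrow> g\<close> of \<open>C/X\<close>, so \<open>g h = f\<close>, where
  \<open>f : T \<rightarrow> X\<close> and \<open>g : S \<rightarrow> X\<close>, is sent to the transpose \<open>\<Sigma>\<^sub>f 1\<^sub>T \<rightarrow> \<Sigma>\<^sub>g 1\<^sub>S\<close> of the composite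
  \<open>1\<^sub>T \<cong> h\<^sup>* 1\<^sub>S \<rightarrow> h\<^sup>* g\<^sup>* \<Sigma>\<^sub>g 1\<^sub>S \<cong> f\<^sup>* \<Sigma>\<^sub>g 1\<^sub>S\<close>.\<close>

definition comprehension_left ::
    "('o, 'a, 'm, 'c, 'p, 'b, 'n, 'd) doctrine \<Rightarrow> 'o \<Rightarrow> ('a, 'a \<times> 'a \<times> 'a, 'p, 'b) ftor" where
  "comprehension_left D X =
    (let one = (\<lambda>f. terminal (fib (PP D) (src (CC D) f)));
         \<Sigma>1 = (\<lambda>f. fo (ladj (Sigma_adj D f)) (one f))
     in
    \<lparr>fo = \<Sigma>1,
     fa = (\<lambda>(f, h, g).
       let PT = fib (PP D) (src (CC D) f) in
       left_transpose (fib (PP D) X) (Sigma_adj D f) (\<Sigma>1 g)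
         (scmp (PP D) h g (\<Sigma>1 g) \<cdot>\<^bsub>PT\<^esub>
           (fa (sub (PP D) h) (unit (Sigma_adj D g) (one g)) \<cdot>\<^bsub>PT\<^esub>
             inverse_arr PT (to_terminal PT (fo (sub (PP D) h) (one g))))))\<rparr>)"

definition comprehension_adj ::
    "('o, 'a, 'm, 'c, 'p, 'b, 'n, 'd) doctrine \<Rightarrow> 'o \<Rightarrow> ('a, 'a \<times> 'a \<times> 'a, 'p, 'b) adj" where
  "comprehension_adj D X =
     right_adjunction (slice (CC D) X) (fib (PP D) X) (comprehension_left D X)"

text \<open>The canonical arrow \<open>\<Sigma>\<^sub>f (p \<times> f\<^sup>* q) \<rightarrow> \<Sigma>\<^sub>f p \<times> q\<close>.\<close>

definition frobenius_arr ::
    "('o, 'a, 'm, 'c, 'p, 'b, 'n, 'd) doctrine \<Rightarrow> 'a \<Rightarrow> 'p \<Rightarrow> 'p \<Rightarrow> 'b" where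
  "frobenius_arr D f p q =
    (let PX = fib (PP D) (src (CC D) f); PY = fib (PP D) (tgt (CC D) f);
         S = Sigma_adj D f; fq = fo (sub (PP D) f) q
     in pairing PY (fa (ladj S) (pr1 PX p fq)) (left_transpose PY S q (pr2 PX p fq)))"

definition BB ::
    "('o, 'a, 'm, 'c, 'p, 'b, 'n, 'd) doctrine \<Rightarrow> 'o \<Rightarrow>
     (('m, 'n, 'b) pb_ob, ('m, 'c, 'n, 'd, 'b) pb_ar) cat" where
  "BB D X = pullback (fib (MM D) X) (fib (MM' D) X) (fib (PP D) X) (fn (ii D) X) (fn (ii' D) X)"

text \<open>\<open>b\<^sub>X = i\<^sub>X j\<^sub>X\<close>, which is isomorphic to \<open>i'\<^sub>X j'\<^sub>X\<close> by the third components of the objects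
  of \<open>B X\<close>.\<close>

definition bb ::
    "('o, 'a, 'm, 'c, 'p, 'b, 'n, 'd) doctrine \<Rightarrow> 'o \<Rightarrow>
     (('m, 'n, 'b) pb_ob, ('m, 'c, 'n, 'd, 'b) pb_ar, 'p, 'b) ftor" where
  "bb D X = fn (ii D) X \<odot> pb_fst"

text \<open>As \<open>B 1\<close> is a pullback up to isomorphism, the requirement that \<open>j\<^sub>1\<close> and \<open>j'\<^sub>1\<close> be
  isomorphisms is understood in the same sense, that is, as being equivalences.\<close>

locale temporal_doctrine =
  i: indexed_functor "CC D" "MM D" "PP D" "ii D" +
  i': indexed_functor "CC D" "MM' D" "PP D" "ii' D"
  for D :: "('o, 'a, 'm, 'c, 'p, 'b, 'n, 'd) doctrine" +
  assumes A1: "\<exists>t. is_terminal (CC D) t"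
    and A2: "X \<in> Ob (CC D) \<Longrightarrow> cartesian_closed (fib (PP D) X)"
    and A3_left: "f \<in> hom (CC D) X Y \<Longrightarrow>
      has_left_adjoint (fib (PP D) X) (fib (PP D) Y) (sub (PP D) f)"
    and A3_right: "f \<in> hom (CC D) X Y \<Longrightarrow>
      has_right_adjoint (fib (PP D) Y) (fib (PP D) X) (sub (PP D) f)"
    and A4_left: "X \<in> Ob (CC D) \<Longrightarrow>
      has_left_adjoint (fib (PP D) X) (fib (MM D) X) (fn (ii D) X)"
    and A4_right: "X \<in> Ob (CC D) \<Longrightarrow>
      has_right_adjoint (fib (MM D) X) (fib (PP D) X) (fn (ii D) X)"
    and A4'_left: "X \<in> Ob (CC D) \<Longrightarrow>
      has_left_adjoint (fib (PP D) X) (fib (MM' D) X) (fn (ii' D) X)"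
    and A4'_right: "X \<in> Ob (CC D) \<Longrightarrow>
      has_right_adjoint (fib (MM' D) X) (fib (PP D) X) (fn (ii' D) X)"
    and A5: "X \<in> Ob (CC D) \<Longrightarrow>
      has_right_adjoint (slice (CC D) X) (fib (PP D) X) (comprehension_left D X)"
    and B1: "X \<in> Ob (CC D) \<Longrightarrow> fully_faithful (fib (MM D) X) (fib (PP D) X) (fn (ii D) X)"
    and B1': "X \<in> Ob (CC D) \<Longrightarrow> fully_faithful (fib (MM' D) X) (fib (PP D) X) (fn (ii' D) X)"
    and B2: "f \<in> hom (CC D) X Y \<Longrightarrow> p \<in> Ob (fib (PP D) X) \<Longrightarrow> q \<in> Ob (fib (PP D) Y) \<Longrightarrow>
      is_iso (fib (PP D) Y) (frobenius_arr D f p q)"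
    and B3: "X \<in> Ob (CC D) \<Longrightarrow> p \<in> Ob (fib (PP D) X) \<Longrightarrow> n \<in> Ob (fib (MM' D) X) \<Longrightarrow>
      is_iso (fib (MM D) X) (fa (ladj (Dia_adj D X))
        (prd_arr (fib (PP D) X) (unit (Dia_adj D X) p) (idt (fib (PP D) X) (fo (fn (ii' D) X) n))))"
    and B3': "X \<in> Ob (CC D) \<Longrightarrow> p \<in> Ob (fib (PP D) X) \<Longrightarrow> m \<in> Ob (fib (MM D) X) \<Longrightarrow>
      is_iso (fib (MM' D) X) (fa (ladj (Dia'_adj D X))
        (prd_arr (fib (PP D) X) (unit (Dia'_adj D X) p) (idt (fib (PP D) X) (fo (fn (ii D) X) m))))"
    and B4: "is_equivalence (BB D (terminal (CC D))) (fib (MM D) (terminal (CC D))) pb_fst"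
    and B4': "is_equivalence (BB D (terminal (CC D))) (fib (MM' D) (terminal (CC D))) pb_snd"
    and B5: "X \<in> Ob (CC D) \<Longrightarrow>
      fully_faithful (fib (PP D) X) (slice (CC D) X) (radj (comprehension_adj D X))"


section \<open>Quantifiers, final and initial maps, limits and colimits\<close>

definition Ex_ftor ::
    "('o, 'a, 'm, 'c, 'p, 'b, 'n, 'd) doctrine \<Rightarrow> 'a \<Rightarrow> ('m, 'c, 'm, 'c) ftor" where
  "Ex_ftor D f =
     ladj (Dia_adj D (tgt (CC D) f)) \<odot> ladj (Sigma_adj D f) \<odot> fn (ii D) (src (CC D) f)"

definition Ex'_ftor ::
    "('o, 'a, 'm, 'c, 'p, 'b, 'n, 'd) doctrine \<Rightarrow> 'a \<Rightarrow> ('n, 'd, 'n, 'd) ftor" where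
  "Ex'_ftor D f =
     ladj (Dia'_adj D (tgt (CC D) f)) \<odot> ladj (Sigma_adj D f) \<odot> fn (ii' D) (src (CC D) f)"

definition final :: "('o, 'a, 'm, 'c, 'p, 'b, 'n, 'd) doctrine \<Rightarrow> 'a \<Rightarrow> bool" where
  "final D f \<longleftrightarrow> isomorphic (fib (MM D) (tgt (CC D) f))
     (fo (Ex_ftor D f) (terminal (fib (MM D) (src (CC D) f))))
     (terminal (fib (MM D) (tgt (CC D) f)))"

definition initial :: "('o, 'a, 'm, 'c, 'p, 'b, 'n, 'd) doctrine \<Rightarrow> 'a \<Rightarrow> bool" where
  "initial D f \<longleftrightarrow> isomorphic (fib (MM' D) (tgt (CC D) f))
     (fo (Ex'_ftor D f) (terminal (fib (MM' D) (src (CC D) f))))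
     (terminal (fib (MM' D) (tgt (CC D) f)))"

text \<open>\<open>BB1 D\<close> is \<open>B 1\<close>, and \<open>const D X\<close> is \<open>X\<^sup>* b\<^sub>1 : B 1 \<rightarrow> P X\<close>.\<close>

definition BB1 ::
    "('o, 'a, 'm, 'c, 'p, 'b, 'n, 'd) doctrine \<Rightarrow>
     (('m, 'n, 'b) pb_ob, ('m, 'c, 'n, 'd, 'b) pb_ar) cat" where
  "BB1 D = BB D (terminal (CC D))"

definition const ::
    "('o, 'a, 'm, 'c, 'p, 'b, 'n, 'd) doctrine \<Rightarrow> 'o \<Rightarrow>
     (('m, 'n, 'b) pb_ob, ('m, 'c, 'n, 'd, 'b) pb_ar, 'p, 'b) ftor" where
  "const D X = sub (PP D) (to_terminal (CC D) X) \<odot> bb D (terminal (CC D))"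

definition End ::
    "('o, 'a, 'm, 'c, 'p, 'b, 'n, 'd) doctrine \<Rightarrow> 'o \<Rightarrow>
     ('p, 'b, ('m, 'n, 'b) pb_ob, ('m, 'c, 'n, 'd, 'b) pb_ar) ftor" where
  "End D X = radj (right_adjunction (BB1 D) (fib (PP D) X) (const D X))"

definition Coend ::
    "('o, 'a, 'm, 'c, 'p, 'b, 'n, 'd) doctrine \<Rightarrow> 'o \<Rightarrow>
     ('p, 'b, ('m, 'n, 'b) pb_ob, ('m, 'c, 'n, 'd, 'b) pb_ar) ftor" where
  "Coend D X = ladj (left_adjunction (fib (PP D) X) (BB1 D) (const D X))"

definition Lim ::
    "('o, 'a, 'm, 'c, 'p, 'b, 'n, 'd) doctrine \<Rightarrow> 'o \<Rightarrow>
     ('m, 'c, ('m, 'n, 'b) pb_ob, ('m, 'c, 'n, 'd, 'b) pb_ar) ftor" where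
  "Lim D X = End D X \<odot> fn (ii D) X"

definition Colim ::
    "('o, 'a, 'm, 'c, 'p, 'b, 'n, 'd) doctrine \<Rightarrow> 'o \<Rightarrow>
     ('m, 'c, ('m, 'n, 'b) pb_ob, ('m, 'c, 'n, 'd, 'b) pb_ar) ftor" where
  "Colim D X = Coend D X \<odot> fn (ii D) X"

definition Lim' ::
    "('o, 'a, 'm, 'c, 'p, 'b, 'n, 'd) doctrine \<Rightarrow> 'o \<Rightarrow>
     ('n, 'd, ('m, 'n, 'b) pb_ob, ('m, 'c, 'n, 'd, 'b) pb_ar) ftor" where
  "Lim' D X = End D X \<odot> fn (ii' D) X"

definition Colim' ::
    "('o, 'a, 'm, 'c, 'p, 'b, 'n, 'd) doctrine \<Rightarrow> 'o \<Rightarrow>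
     ('n, 'd, ('m, 'n, 'b) pb_ob, ('m, 'c, 'n, 'd, 'b) pb_ar) ftor" where
  "Colim' D X = Coend D X \<odot> fn (ii' D) X"

end

theory Submission
  imports Defs
begin

text \<open>The key point is that, for final \<open>f : X \<rightarrow> Y\<close>, the functor \<open>f\<^sup>*\<close> is bijective on the arrows
  \<open>i' N \<rightarrow> i M\<close> of \<open>P Y\<close>.  Transposing along \<open>\<Sigma>\<^sub>f \<stileturn> f\<^sup>*\<close> and \<open>\<diamond> \<stileturn> i\<close>, this says that \<open>\<diamond>\<close> inverts the
  counit \<open>\<Sigma>\<^sub>f f\<^sup>* (i' N) \<rightarrow> i' N\<close>.  By the Frobenius law this counit is the projection
  \<open>\<Sigma>\<^sub>f 1 \<times> i' N \<rightarrow> i' N\<close>, and by the mixed Frobenius law \<open>\<Sigma>\<^sub>f 1\<close> may be replaced by \<open>i (\<diamond> (\<Sigma>\<^sub>f 1))\<close>,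
  which finality makes terminal.  Since the constant objects \<open>Y\<^sup>* b\<^sub>1 B\<close> lie in the images of both \<open>i\<close>
  and \<open>i'\<close>, taking one of \<open>i M\<close>, \<open>i' N\<close> constant gives a bijection between the cones (cocones)
  over \<open>Y\<close> and over \<open>X\<close>, hence isomorphic limits (colimits).  The initial case exchanges \<open>M\<close> and \<open>M'\<close>.\<close>

section \<open>Composition and isomorphisms\<close>

context category
begin

lemma arrI: "a \<in> hom A x y \<Longrightarrow> a \<in> Ar A \<and> src A a = x \<and> tgt A a = y"
  by (simp add: hom_def)

lemma Ar_cmp [simp]: "a \<in> Ar A \<Longrightarrow> b \<in> Ar A \<Longrightarrow> src A b = tgt A a \<Longrightarrow> b \<cdot>\<^bsub>A\<^esub> a \<in> Ar A"
  and src_cmp [simp]: "a \<in> Ar A \<Longrightarrow> b \<in> Ar A \<Longrightarrow> src A b = tgt A a \<Longrightarrow> src A (b \<cdot>\<^bsub>A\<^esub> a) = src A a"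
  and tgt_cmp [simp]: "a \<in> Ar A \<Longrightarrow> b \<in> Ar A \<Longrightarrow> src A b = tgt A a \<Longrightarrow> tgt A (b \<cdot>\<^bsub>A\<^esub> a) = tgt A b"
  using cmp_in[of a "src A a" "tgt A a" b "tgt A b"] by (auto simp: hom_def)

lemma Ar_idt [simp]: "x \<in> Ob A \<Longrightarrow> idt A x \<in> Ar A"
  and src_idt [simp]: "x \<in> Ob A \<Longrightarrow> src A (idt A x) = x"
  and tgt_idt [simp]: "x \<in> Ob A \<Longrightarrow> tgt A (idt A x) = x"
  using idt_in[of x] by (auto simp: hom_def)

lemma cmp_idt_right [simp]: "a \<in> Ar A \<Longrightarrow> src A a = x \<Longrightarrow> a \<cdot>\<^bsub>A\<^esub> idt A x = a"
  and cmp_idt_left [simp]: "a \<in> Ar A \<Longrightarrow> tgt A a = x \<Longrightarrow> idt A x \<cdot>\<^bsub>A\<^esub> a = a"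
  using cmp_idt idt_cmp by (auto simp: hom_def)

lemma assoc [simp]:
  "a \<in> Ar A \<Longrightarrow> b \<in> Ar A \<Longrightarrow> c \<in> Ar A \<Longrightarrow> src A b = tgt A a \<Longrightarrow> src A c = tgt A b \<Longrightarrow>
    (c \<cdot>\<^bsub>A\<^esub> b) \<cdot>\<^bsub>A\<^esub> a = c \<cdot>\<^bsub>A\<^esub> (b \<cdot>\<^bsub>A\<^esub> a)"
  using cmp_assoc[of a "src A a" "tgt A a" b "tgt A b" c "tgt A c"] by (auto simp: hom_def)

lemma hom_obs: "a \<in> hom A x y \<Longrightarrow> x \<in> Ob A \<and> y \<in> Ob A"
  using src_in tgt_in by (auto simp: hom_def)

text \<open>Since \<open>assoc\<close> is a simp rule that nests composites to the right, an
  equation for \<open>b\<close> after \<open>a\<close> no longer matches once \<open>a\<close> is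
  precomposed with \<open>k\<close>. This form restates it for the nested composite.\<close>

lemma reassoc:
  "b \<cdot>\<^bsub>A\<^esub> a = c \<Longrightarrow> a \<in> Ar A \<Longrightarrow> b \<in> Ar A \<Longrightarrow> k \<in> Ar A \<Longrightarrow> src A b = tgt A a \<Longrightarrow> src A a = tgt A k \<Longrightarrow>
    b \<cdot>\<^bsub>A\<^esub> (a \<cdot>\<^bsub>A\<^esub> k) = c \<cdot>\<^bsub>A\<^esub> k"
  using assoc[of k a b] by simp

lemma is_isoI:
  "a \<in> hom A x y \<Longrightarrow> b \<in> hom A y x \<Longrightarrow> b \<cdot>\<^bsub>A\<^esub> a = idt A x \<Longrightarrow> a \<cdot>\<^bsub>A\<^esub> b = idt A y \<Longrightarrow> is_iso A a"
  unfolding is_iso_def is_inverse_def hom_def by auto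

lemma is_isoE:
  assumes "is_iso A a" "a \<in> hom A x y"
  obtains b where "b \<in> hom A y x" "b \<cdot>\<^bsub>A\<^esub> a = idt A x" "a \<cdot>\<^bsub>A\<^esub> b = idt A y" "is_iso A b"
  using assms unfolding is_iso_def is_inverse_def hom_def by auto

lemma iso_idt: "x \<in> Ob A \<Longrightarrow> is_iso A (idt A x)"
  using is_isoI[OF idt_in idt_in] by simp

lemma iso_cmp:
  assumes "is_iso A a" "is_iso A b" "a \<in> hom A x y" "b \<in> hom A y z"
  shows "is_iso A (b \<cdot>\<^bsub>A\<^esub> a)"
proof -
  obtain a' where a': "a' \<in> hom A y x" "a' \<cdot>\<^bsub>A\<^esub> a = idt A x" "a \<cdot>\<^bsub>A\<^esub> a' = idt A y"
    using assms is_isoE by metis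
  obtain b' where b': "b' \<in> hom A z y" "b' \<cdot>\<^bsub>A\<^esub> b = idt A y" "b \<cdot>\<^bsub>A\<^esub> b' = idt A z"
    using assms is_isoE by metis
  note t = arrI[OF assms(3)] arrI[OF assms(4)] arrI[OF a'(1)] arrI[OF b'(1)]
  show ?thesis
  proof (rule is_isoI)
    show "b \<cdot>\<^bsub>A\<^esub> a \<in> hom A x z" "a' \<cdot>\<^bsub>A\<^esub> b' \<in> hom A z x"
      using t by (auto simp: hom_def)
    show "(a' \<cdot>\<^bsub>A\<^esub> b') \<cdot>\<^bsub>A\<^esub> (b \<cdot>\<^bsub>A\<^esub> a) = idt A x"
      using t a' reassoc[OF b'(2)] by simp
    show "(b \<cdot>\<^bsub>A\<^esub> a) \<cdot>\<^bsub>A\<^esub> (a' \<cdot>\<^bsub>A\<^esub> b') = idt A z"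
      using t b' reassoc[OF a'(3)] by simp
  qed
qed

lemma iso_cancel_right:
  assumes "is_iso A a" "is_iso A (b \<cdot>\<^bsub>A\<^esub> a)" "a \<in> hom A x y" "b \<in> hom A y z"
  shows "is_iso A b"
proof -
  obtain a' where a': "a' \<in> hom A y x" "a \<cdot>\<^bsub>A\<^esub> a' = idt A y" "is_iso A a'"
    using assms is_isoE by metis
  have "(b \<cdot>\<^bsub>A\<^esub> a) \<cdot>\<^bsub>A\<^esub> a' = b"
    using arrI[OF assms(3)] arrI[OF assms(4)] arrI[OF a'(1)] a'(2) by simp
  then show ?thesis
    using iso_cmp[OF a'(3) assms(2) a'(1) cmp_in[OF assms(3,4)]] by simp
qed

lemma isomorphicI: "a \<in> hom A x y \<Longrightarrow> is_iso A a \<Longrightarrow> isomorphic A x y"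
  unfolding isomorphic_def by auto

lemma isomorphic_sym: "isomorphic A x y \<Longrightarrow> isomorphic A y x"
  unfolding isomorphic_def by (metis is_isoE)

lemma isomorphic_trans: "isomorphic A x y \<Longrightarrow> isomorphic A y z \<Longrightarrow> isomorphic A x z"
  unfolding isomorphic_def by (metis iso_cmp cmp_in)

text \<open>Conjugating with the inverses of \<open>h\<close> and \<open>k\<close> undoes the
  map.\<close>

lemma bij_betw_conj:
  assumes "h \<in> hom A x' x" "is_iso A h" "k \<in> hom A y y'" "is_iso A k"
  shows "bij_betw (\<lambda>a. k \<cdot>\<^bsub>A\<^esub> (a \<cdot>\<^bsub>A\<^esub> h)) (hom A x y) (hom A x' y')"
proof -
  obtain h' where h': "h' \<in> hom A x x'" "h' \<cdot>\<^bsub>A\<^esub> h = idt A x'" "h \<cdot>\<^bsub>A\<^esub> h' = idt A x"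
    using assms is_isoE by metis
  obtain k' where k': "k' \<in> hom A y' y" "k' \<cdot>\<^bsub>A\<^esub> k = idt A y" "k \<cdot>\<^bsub>A\<^esub> k' = idt A y'"
    using assms is_isoE by metis
  note t = arrI[OF assms(1)] arrI[OF assms(3)] arrI[OF h'(1)] arrI[OF k'(1)]
  show ?thesis
    by (rule bij_betw_byWitness[where f' = "\<lambda>a. k' \<cdot>\<^bsub>A\<^esub> (a \<cdot>\<^bsub>A\<^esub> h')"])
      (use t h' k' reassoc[OF k'(2)] reassoc[OF k'(3)] in \<open>auto simp: hom_def\<close>)
qed

text \<open>A Yoneda argument: surjectivity at \<open>y\<close> yields a section \<open>s\<close> of
  \<open>t\<close>; then \<open>t s t = t\<close>, and injectivity at \<open>x\<close> gives
  \<open>s t = id\<close>.\<close>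

lemma iso_if_bij_postcompose:
  assumes t: "t \<in> hom A x y"
    and bij: "\<And>z. z \<in> Ob A \<Longrightarrow> bij_betw (\<lambda>a. t \<cdot>\<^bsub>A\<^esub> a) (hom A z x) (hom A z y)"
  shows "is_iso A t"
proof -
  have x: "x \<in> Ob A" and y: "y \<in> Ob A" using hom_obs[OF t] by auto
  have "idt A y \<in> (\<lambda>a. t \<cdot>\<^bsub>A\<^esub> a) ` hom A y x"
    using bij[OF y] idt_in[OF y] by (simp add: bij_betw_def)
  then obtain s where s: "s \<in> hom A y x" "t \<cdot>\<^bsub>A\<^esub> s = idt A y" by auto
  note ty = arrI[OF t] arrI[OF s(1)]
  have "t \<cdot>\<^bsub>A\<^esub> (s \<cdot>\<^bsub>A\<^esub> t) = t \<cdot>\<^bsub>A\<^esub> idt A x"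
    using ty reassoc[OF s(2)] by simp
  then have "s \<cdot>\<^bsub>A\<^esub> t = idt A x"
    using bij[OF x] cmp_in[OF t s(1)] idt_in[OF x] by (auto simp: bij_betw_def dest: inj_onD)
  then show ?thesis using is_isoI[OF t s(1)] s(2) by simp
qed

lemma terminal_isomorphic:
  assumes "is_terminal A t" "is_terminal A s"
  shows "isomorphic A t s"
proof -
  have ob: "t \<in> Ob A" "s \<in> Ob A" using assms by (auto simp: is_terminal_def)
  obtain a b where ab: "a \<in> hom A t s" "b \<in> hom A s t"
    using assms by (metis is_terminal_def)
  have "b \<cdot>\<^bsub>A\<^esub> a = idt A t" "a \<cdot>\<^bsub>A\<^esub> b = idt A s"
    using assms cmp_in[OF ab] cmp_in[OF ab(2,1)] idt_in[OF ob(1)] idt_in[OF ob(2)] ob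
    by (metis is_terminal_def)+
  then show ?thesis using isomorphicI[OF ab(1)] is_isoI[OF ab] by simp
qed

lemma terminal_if_isomorphic:
  assumes "is_terminal A t" "isomorphic A s t"
  shows "is_terminal A s"
proof -
  obtain h where h: "h \<in> hom A s t" "is_iso A h"
    using assms(2) by (auto simp: isomorphic_def)
  obtain h' where h': "h' \<in> hom A t s" "h' \<cdot>\<^bsub>A\<^esub> h = idt A s"
    using is_isoE[OF h(2,1)] by metis
  have "\<exists>!a. a \<in> hom A x s" if x: "x \<in> Ob A" for x
  proof -
    obtain a where a: "a \<in> hom A x t" using assms(1) x by (auto simp: is_terminal_def)
    have "b = h' \<cdot>\<^bsub>A\<^esub> a" if b: "b \<in> hom A x s" for b
    proof -
      have "h \<cdot>\<^bsub>A\<^esub> b = a"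
        using assms(1) x a cmp_in[OF b h(1)] by (auto simp: is_terminal_def)
      then show ?thesis
        using reassoc[OF h'(2)] arrI[OF h(1)] arrI[OF h'(1)] arrI[OF b] by force
    qed
    then show ?thesis using cmp_in[OF a h'(1)] by blast
  qed
  then show ?thesis using hom_obs[OF h(1)] by (auto simp: is_terminal_def)
qed

lemma terminal_is_terminal: "\<exists>t. is_terminal A t \<Longrightarrow> is_terminal A (terminal A)"
  unfolding terminal_def by (rule someI_ex)

lemma to_terminal_in:
  "\<exists>t. is_terminal A t \<Longrightarrow> x \<in> Ob A \<Longrightarrow> to_terminal A x \<in> hom A x (terminal A)"
  unfolding to_terminal_def by (rule theI') (use terminal_is_terminal in \<open>auto simp: is_terminal_def\<close>)

lemma to_terminal_eq:
  "\<exists>t. is_terminal A t \<Longrightarrow> a \<in> hom A x (terminal A) \<Longrightarrow> a = to_terminal A x"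
  using to_terminal_in[of x] terminal_is_terminal hom_obs[of a x] by (auto simp: is_terminal_def)

end

section \<open>Functors and natural isomorphisms\<close>

context is_functor
begin

lemma Ob_fo [simp]: "x \<in> Ob A \<Longrightarrow> fo F x \<in> Ob B"
  by (rule fo_in)

lemma Ar_fa [simp]: "a \<in> Ar A \<Longrightarrow> fa F a \<in> Ar B"
  and src_fa [simp]: "a \<in> Ar A \<Longrightarrow> src B (fa F a) = fo F (src A a)"
  and tgt_fa [simp]: "a \<in> Ar A \<Longrightarrow> tgt B (fa F a) = fo F (tgt A a)"
  using fa_in[of a "src A a" "tgt A a"] by (auto simp: hom_def)

lemma fa_cmp_Ar [simp]:
  "a \<in> Ar A \<Longrightarrow> b \<in> Ar A \<Longrightarrow> src A b = tgt A a \<Longrightarrow> fa F (b \<cdot>\<^bsub>A\<^esub> a) = fa F b \<cdot>\<^bsub>B\<^esub> fa F a"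
  using fa_cmp[of a "src A a" "tgt A a" b] by (auto simp: hom_def)

lemma fa_idt_simp [simp]: "x \<in> Ob A \<Longrightarrow> fa F (idt A x) = idt B (fo F x)"
  by (rule fa_idt)

lemma fa_iso:
  assumes "is_iso A a" "a \<in> hom A x y"
  shows "is_iso B (fa F a)"
proof -
  obtain b where b: "b \<in> hom A y x" "b \<cdot>\<^bsub>A\<^esub> a = idt A x" "a \<cdot>\<^bsub>A\<^esub> b = idt A y"
    using assms dom.is_isoE by metis
  have "fa F b \<cdot>\<^bsub>B\<^esub> fa F a = idt B (fo F x)" "fa F a \<cdot>\<^bsub>B\<^esub> fa F b = idt B (fo F y)"
    using fa_cmp[OF assms(2) b(1)] fa_cmp[OF b(1) assms(2)] b fa_idt dom.hom_obs[OF b(1)] by auto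
  then show ?thesis using cod.is_isoI[OF fa_in fa_in] assms(2) b(1) by blast
qed

lemma isomorphic_fo: "isomorphic A x y \<Longrightarrow> isomorphic B (fo F x) (fo F y)"
  unfolding isomorphic_def using fa_iso fa_in by metis

end

lemma is_functor_cmp:
  assumes "is_functor A B F" "is_functor B C G"
  shows "is_functor A C (G \<odot> F)"
proof -
  interpret F: is_functor A B F by fact
  interpret G: is_functor B C G by fact
  show ?thesis
    by unfold_locales (auto simp: cmp_ftor_def hom_def)
qed

lemma cmp_ftor_assoc: "(H \<odot> G) \<odot> F = H \<odot> (G \<odot> F)"
  by (simp add: cmp_ftor_def)

lemma fo_cmp_ftor [simp]: "fo (G \<odot> F) x = fo G (fo F x)"
  and fa_cmp_ftor [simp]: "fa (G \<odot> F) a = fa G (fa F a)"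
  by (simp_all add: cmp_ftor_def)

lemma fo_id_ftor [simp]: "fo id_ftor x = x"
  and fa_id_ftor [simp]: "fa id_ftor a = a"
  by (simp_all add: id_ftor_def)

lemma (in nat_trans) Ar_component [simp]: "x \<in> Ob A \<Longrightarrow> t x \<in> Ar B"
  and src_component [simp]: "x \<in> Ob A \<Longrightarrow> src B (t x) = fo F x"
  and tgt_component [simp]: "x \<in> Ob A \<Longrightarrow> tgt B (t x) = fo G x"
  using component_in by (auto simp: hom_def)

lemma nat_isoI:
  assumes "is_functor A B F" "is_functor A B G"
    and "\<And>x. x \<in> Ob A \<Longrightarrow> t x \<in> hom B (fo F x) (fo G x)"
    and "\<And>x. x \<in> Ob A \<Longrightarrow> is_iso B (t x)"
    and "\<And>a x y. a \<in> hom A x y \<Longrightarrow> t y \<cdot>\<^bsub>B\<^esub> fa F a = fa G a \<cdot>\<^bsub>B\<^esub> t x"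
  shows "nat_iso A B F G t"
  using assms
  by (auto simp: nat_iso_def nat_trans_def nat_trans_axioms_def nat_iso_axioms_def)

text \<open>The componentwise inverses are again natural. Symmetry matters because passing to
  opposite categories reverses the direction of a transformation.\<close>

lemma nat_isomorphic_sym:
  assumes "nat_isomorphic A B F G"
  shows "nat_isomorphic A B G F"
proof -
  obtain t where "nat_iso A B F G t" using assms by (auto simp: nat_isomorphic_def)
  then interpret nat_iso A B F G t .
  have "\<exists>s. s \<in> hom B (fo G x) (fo F x) \<and> s \<cdot>\<^bsub>B\<^esub> t x = idt B (fo F x) \<and> t x \<cdot>\<^bsub>B\<^esub> s = idt B (fo G x)
      \<and> is_iso B s" if "x \<in> Ob A" for x
    using F.cod.is_isoE[OF component_iso component_in] that by metis
  then obtain s where s: "\<And>x. x \<in> Ob A \<Longrightarrow> s x \<in> hom B (fo G x) (fo F x)"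
      "\<And>x. x \<in> Ob A \<Longrightarrow> s x \<cdot>\<^bsub>B\<^esub> t x = idt B (fo F x)"
      "\<And>x. x \<in> Ob A \<Longrightarrow> t x \<cdot>\<^bsub>B\<^esub> s x = idt B (fo G x)"
      "\<And>x. x \<in> Ob A \<Longrightarrow> is_iso B (s x)"
    by metis
  have "nat_iso A B G F s"
  proof (rule nat_isoI)
    fix a x y assume a: "a \<in> hom A x y"
    then have o: "x \<in> Ob A" "y \<in> Ob A" and a': "a \<in> Ar A" "src A a = x" "tgt A a = y"
      using F.dom.hom_obs F.dom.arrI by blast+
    note ty = a' o F.cod.arrI[OF s(1)[OF o(1)]] F.cod.arrI[OF s(1)[OF o(2)]]
    \<comment> \<open>Inserting \<open>t x\<close> after \<open>s x\<close>, which is an identity,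
      exposes the naturality square of \<open>t\<close>; afterwards \<open>s y\<close> cancels
      against \<open>t y\<close>.\<close>
    have "s y \<cdot>\<^bsub>B\<^esub> fa G a = s y \<cdot>\<^bsub>B\<^esub> ((fa G a \<cdot>\<^bsub>B\<^esub> t x) \<cdot>\<^bsub>B\<^esub> s x)"
      using ty s(3)[OF o(1)] by simp
    also have "\<dots> = (s y \<cdot>\<^bsub>B\<^esub> t y) \<cdot>\<^bsub>B\<^esub> (fa F a \<cdot>\<^bsub>B\<^esub> s x)"
      unfolding natural[OF a, symmetric] using ty by simp
    also have "\<dots> = fa F a \<cdot>\<^bsub>B\<^esub> s x"
      using ty s(2)[OF o(2)] by simp
    finally show "s y \<cdot>\<^bsub>B\<^esub> fa G a = fa F a \<cdot>\<^bsub>B\<^esub> s x" .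
  qed (use s F.is_functor_axioms G.is_functor_axioms in auto)
  then show ?thesis by (auto simp: nat_isomorphic_def)
qed


section \<open>Opposite categories\<close>

text \<open>Arrows stay the same elements and only their direction changes. Hence the double
  opposite is equal to \<open>A\<close>, and the same functor record serves as a functor between the
  opposites, so duality works by plain rewriting.\<close>

definition op_cat :: "('o, 'a) cat \<Rightarrow> ('o, 'a) cat" where
  "op_cat A = \<lparr>Ob = Ob A, Ar = Ar A, src = tgt A, tgt = src A, idt = idt A, cmp = \<lambda>g f. f \<cdot>\<^bsub>A\<^esub> g\<rparr>"

definition op_adj :: "('o, 'a, 'p, 'b) adj \<Rightarrow> ('p, 'b, 'o, 'a) adj" where
  "op_adj J = \<lparr>ladj = radj J, radj = ladj J, unit = counit J, counit = unit J\<rparr>"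

lemma op_cat_sel [simp]:
  "Ob (op_cat A) = Ob A" "Ar (op_cat A) = Ar A" "src (op_cat A) = tgt A" "tgt (op_cat A) = src A"
  "idt (op_cat A) = idt A" "g \<cdot>\<^bsub>op_cat A\<^esub> f = f \<cdot>\<^bsub>A\<^esub> g" "hom (op_cat A) x y = hom A y x"
  by (auto simp: op_cat_def hom_def)

lemma op_adj_sel [simp]:
  "ladj (op_adj J) = radj J" "radj (op_adj J) = ladj J"
  "unit (op_adj J) = counit J" "counit (op_adj J) = unit J"
  by (auto simp: op_adj_def)

lemma op_op [simp]: "op_cat (op_cat A) = A" "op_adj (op_adj J) = J"
  by (simp_all add: op_cat_def op_adj_def)

lemma is_iso_op [simp]: "is_iso (op_cat A) a = is_iso A a"
  unfolding is_iso_def is_inverse_def by auto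

lemma category_op: "category A \<Longrightarrow> category (op_cat A)"
proof -
  assume "category A"
  then interpret category A .
  show ?thesis
    by unfold_locales (auto simp: hom_def src_in tgt_in)
qed

lemma is_functor_op: "is_functor A B F \<Longrightarrow> is_functor (op_cat A) (op_cat B) F"
proof -
  assume "is_functor A B F"
  then interpret is_functor A B F .
  interpret oA: category "op_cat A" by (rule category_op[OF dom.category_axioms])
  interpret oB: category "op_cat B" by (rule category_op[OF cod.category_axioms])
  show ?thesis
    by unfold_locales (auto simp: hom_def)
qed

lemma nat_trans_op: "nat_trans A B F G t \<Longrightarrow> nat_trans (op_cat A) (op_cat B) G F t"
proof -
  assume "nat_trans A B F G t"
  then interpret nat_trans A B F G t .
  show ?thesis
    using is_functor_op[OF F.is_functor_axioms] is_functor_op[OF G.is_functor_axioms]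
    by (auto simp: nat_trans_def nat_trans_axioms_def natural component_in)
qed

text \<open>In the opposite categories the transformation runs from \<open>G\<close> to
  \<open>F\<close>; symmetry restores the order.\<close>

lemma nat_isomorphic_op:
  assumes "nat_isomorphic A B F G"
  shows "nat_isomorphic (op_cat A) (op_cat B) F G"
proof -
  obtain t where "nat_iso A B F G t" using assms by (auto simp: nat_isomorphic_def)
  then have "nat_iso (op_cat A) (op_cat B) G F t"
    using nat_trans_op[of A B F G t] by (auto simp: nat_iso_def nat_iso_axioms_def)
  then have "nat_isomorphic (op_cat A) (op_cat B) G F" by (auto simp: nat_isomorphic_def)
  then show ?thesis by (rule nat_isomorphic_sym)
qed

lemma adjunction_op:
  assumes "adjunction A B J"
  shows "adjunction (op_cat B) (op_cat A) (op_adj J)"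
proof -
  interpret adjunction A B J by fact
  show ?thesis
  proof (unfold adjunction_def adjunction_axioms_def op_adj_sel op_cat_sel, intro conjI allI impI)
    show "is_functor (op_cat B) (op_cat A) (radj J)" "is_functor (op_cat A) (op_cat B) (ladj J)"
      using is_functor_op L.is_functor_axioms R.is_functor_axioms by blast+
    show "nat_trans (op_cat B) (op_cat B) id_ftor (ladj J \<odot> radj J) (counit J)"
      "nat_trans (op_cat A) (op_cat A) (radj J \<odot> ladj J) id_ftor (unit J)"
      by (rule nat_trans_op[OF counit.nat_trans_axioms] nat_trans_op[OF unit.nat_trans_axioms])+
  qed (fact triangle_right triangle_left)+
qed

text \<open>\<open>op_adj\<close> exchanges the two sides of an adjunction, so right adjoints need
  no separate construction.\<close>

lemma has_right_adjoint_op: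
  "has_left_adjoint (op_cat B) (op_cat A) F \<Longrightarrow> has_right_adjoint A B F"
  unfolding has_left_adjoint_def has_right_adjoint_def
  using adjunction_op by (metis op_adj_sel(1) op_op(1))

lemma has_left_adjoint_op:
  "has_right_adjoint A B F \<Longrightarrow> has_left_adjoint (op_cat B) (op_cat A) F"
  unfolding has_left_adjoint_def has_right_adjoint_def
  using adjunction_op by (metis op_adj_sel(2))

lemma is_equivalence_op: "is_equivalence A B F \<Longrightarrow> is_equivalence (op_cat A) (op_cat B) F"
  unfolding is_equivalence_def using is_functor_op nat_isomorphic_op by metis


section \<open>Universal arrows and the existence of adjoints\<close>

text \<open>This says that \<open>(y, e)\<close> is an initial object of the comma category of
  \<open>x\<close> over \<open>G\<close>.\<close>

definition universal_arr ::
    "('o, 'a) cat \<Rightarrow> ('p, 'b) cat \<Rightarrow> ('p, 'b, 'o, 'a) ftor \<Rightarrow> 'o \<Rightarrow> 'p \<Rightarrow> 'a \<Rightarrow> bool" where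
  "universal_arr A B G x y e \<longleftrightarrow> y \<in> Ob B \<and> e \<in> hom A x (fo G y) \<and>
     (\<forall>z \<in> Ob B. \<forall>u \<in> hom A x (fo G z). \<exists>!v. v \<in> hom B y z \<and> fa G v \<cdot>\<^bsub>A\<^esub> e = u)"

lemma universal_arrD:
  assumes "universal_arr A B G x y e"
  shows "y \<in> Ob B" "e \<in> hom A x (fo G y)"
    and "z \<in> Ob B \<Longrightarrow> u \<in> hom A x (fo G z) \<Longrightarrow> \<exists>v. v \<in> hom B y z \<and> fa G v \<cdot>\<^bsub>A\<^esub> e = u"
    and "z \<in> Ob B \<Longrightarrow> v \<in> hom B y z \<Longrightarrow> w \<in> hom B y z \<Longrightarrow> fa G v \<cdot>\<^bsub>A\<^esub> e = fa G w \<cdot>\<^bsub>A\<^esub> e \<Longrightarrow>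
      fa G w \<cdot>\<^bsub>A\<^esub> e \<in> hom A x (fo G z) \<Longrightarrow> v = w"
proof -
  show "y \<in> Ob B" "e \<in> hom A x (fo G y)" using assms by (simp_all add: universal_arr_def)
  have ex1: "\<exists>!v. v \<in> hom B y z \<and> fa G v \<cdot>\<^bsub>A\<^esub> e = u" if "z \<in> Ob B" "u \<in> hom A x (fo G z)" for z u
    using assms that by (simp add: universal_arr_def)
  show "\<exists>v. v \<in> hom B y z \<and> fa G v \<cdot>\<^bsub>A\<^esub> e = u" if "z \<in> Ob B" "u \<in> hom A x (fo G z)"
    using ex1_implies_ex[OF ex1[OF that]] .
  show "v = w" if "z \<in> Ob B" "v \<in> hom B y z" "w \<in> hom B y z" "fa G v \<cdot>\<^bsub>A\<^esub> e = fa G w \<cdot>\<^bsub>A\<^esub> e"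
      "fa G w \<cdot>\<^bsub>A\<^esub> e \<in> hom A x (fo G z)"
    using ex1[OF that(1,5)] that(2-4) by metis
qed

section \<open>Transposition along an adjunction\<close>

context adjunction
begin

lemmas natural_unit = unit.natural[simplified]
lemmas natural_counit = counit.natural[simplified]

text \<open>The two transposes are mutually inverse: one composite is reduced by naturality of the
  counit and the left triangle, the other by naturality of the unit and the right triangle.\<close>

lemma bij_transpose:
  assumes x: "x \<in> Ob A" and y: "y \<in> Ob B"
  shows "bij_betw (\<lambda>u. counit J y \<cdot>\<^bsub>B\<^esub> fa (ladj J) u)
    (hom A x (fo (radj J) y)) (hom B (fo (ladj J) x) y)"
    and "bij_betw (\<lambda>v. fa (radj J) v \<cdot>\<^bsub>A\<^esub> unit J x)
    (hom B (fo (ladj J) x) y) (hom A x (fo (radj J) y))"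
proof -
  let ?\<phi> = "\<lambda>u. counit J y \<cdot>\<^bsub>B\<^esub> fa (ladj J) u" and ?\<psi> = "\<lambda>v. fa (radj J) v \<cdot>\<^bsub>A\<^esub> unit J x"
  have \<phi>: "?\<phi> u \<in> hom B (fo (ladj J) x) y" if "u \<in> hom A x (fo (radj J) y)" for u
    using L.dom.arrI[OF that] y by (auto simp: hom_def)
  have \<psi>: "?\<psi> v \<in> hom A x (fo (radj J) y)" if "v \<in> hom B (fo (ladj J) x) y" for v
    using L.cod.arrI[OF that] x by (auto simp: hom_def)
  have \<phi>\<psi>: "?\<phi> (?\<psi> v) = v" if v: "v \<in> hom B (fo (ladj J) x) y" for v
  proof -
    note ty = L.cod.arrI[OF v] x y
    have "?\<phi> (?\<psi> v) = (counit J y \<cdot>\<^bsub>B\<^esub> fa (ladj J) (fa (radj J) v)) \<cdot>\<^bsub>B\<^esub> fa (ladj J) (unit J x)"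
      using ty by simp
    also have "\<dots> = v" unfolding natural_counit[OF v] using ty triangle_left by simp
    finally show ?thesis .
  qed
  have \<psi>\<phi>: "?\<psi> (?\<phi> u) = u" if u: "u \<in> hom A x (fo (radj J) y)" for u
  proof -
    note ty = L.dom.arrI[OF u] x y
    have "?\<psi> (?\<phi> u) = fa (radj J) (counit J y) \<cdot>\<^bsub>A\<^esub> (fa (radj J) (fa (ladj J) u) \<cdot>\<^bsub>A\<^esub> unit J x)"
      using ty by simp
    also have "\<dots> = u" unfolding natural_unit[OF u, symmetric]
      using ty L.dom.reassoc[OF triangle_right[OF y], of u] by simp
    finally show ?thesis .
  qed
  show "bij_betw ?\<phi> (hom A x (fo (radj J) y)) (hom B (fo (ladj J) x) y)"
    by (rule bij_betw_byWitness[where f' = ?\<psi>]) (use \<phi> \<psi> \<phi>\<psi> \<psi>\<phi> in auto)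
  show "bij_betw ?\<psi> (hom B (fo (ladj J) x) y) (hom A x (fo (radj J) y))"
    by (rule bij_betw_byWitness[where f' = ?\<phi>]) (use \<phi> \<psi> \<phi>\<psi> \<psi>\<phi> in auto)
qed

lemma universal_unit:
  assumes x: "x \<in> Ob A"
  shows "universal_arr A B (radj J) x (fo (ladj J) x) (unit J x)"
proof -
  have "\<exists>!v. v \<in> hom B (fo (ladj J) x) z \<and> fa (radj J) v \<cdot>\<^bsub>A\<^esub> unit J x = u"
    if "z \<in> Ob B" "u \<in> hom A x (fo (radj J) z)" for z u
  proof (rule ex_ex1I)
    note b = bij_transpose(2)[OF x that(1)]
    have "u \<in> (\<lambda>v. fa (radj J) v \<cdot>\<^bsub>A\<^esub> unit J x) ` hom B (fo (ladj J) x) z"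
      using bij_betw_imp_surj_on[OF b] that(2) by simp
    then show "\<exists>v. v \<in> hom B (fo (ladj J) x) z \<and> fa (radj J) v \<cdot>\<^bsub>A\<^esub> unit J x = u" by auto
    show "v = w" if "v \<in> hom B (fo (ladj J) x) z \<and> fa (radj J) v \<cdot>\<^bsub>A\<^esub> unit J x = u"
      "w \<in> hom B (fo (ladj J) x) z \<and> fa (radj J) w \<cdot>\<^bsub>A\<^esub> unit J x = u" for v w
      using inj_onD[OF bij_betw_imp_inj_on[OF b]] that by simp
  qed
  then show ?thesis
    using x unit.component_in[OF x] by (simp add: universal_arr_def)
qed

end

text \<open>Chosen universal arrows \<open>e x\<close> become the unit. \<open>Fa a\<close> is the
  factorization of \<open>e\<close> after \<open>a\<close>, and the counit \<open>k y\<close> is the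
  factorization of the identity of \<open>G y\<close>, which is already one triangle law.
  Functoriality, naturality of \<open>k\<close> and the other triangle law follow from uniqueness of
  factorizations.\<close>

lemma has_left_adjointI:
  fixes A :: "('o, 'a) cat" and B :: "('p, 'b) cat"
  assumes "is_functor B A G" and univ: "\<And>x. x \<in> Ob A \<Longrightarrow> \<exists>y e. universal_arr A B G x y e"
  shows "has_left_adjoint A B G"
proof -
  interpret G: is_functor B A G by fact
  obtain Fo e where U: "\<And>x. x \<in> Ob A \<Longrightarrow> universal_arr A B G x (Fo x) (e x)"
    using univ by metis
  have Fo [simp]: "Fo x \<in> Ob B" and e: "e x \<in> hom A x (fo G (Fo x))" if "x \<in> Ob A" for x
    using universal_arrD(1,2)[OF U[OF that]] by auto
  have e' [simp]: "e x \<in> Ar A" "src A (e x) = x" "tgt A (e x) = fo G (Fo x)" if "x \<in> Ob A" for x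
    using e[OF that] by (auto simp: hom_def)
  \<comment> \<open>All equations between arrows out of \<open>Fo x\<close> are proved by applying
    \<open>G\<close> and precomposing with \<open>e x\<close>.\<close>
  have uniq: "v = w" if "x \<in> Ob A" "v \<in> hom B (Fo x) z" "w \<in> hom B (Fo x) z"
      "fa G v \<cdot>\<^bsub>A\<^esub> e x = fa G w \<cdot>\<^bsub>A\<^esub> e x" for v w x z
    using universal_arrD(4)[OF U[OF that(1)] _ that(2-4)] G.dom.hom_obs[OF that(2)]
      G.cod.cmp_in[OF e[OF that(1)] G.fa_in[OF that(3)]] by blast
  have "\<exists>Fa. a \<in> Ar A \<longrightarrow> Fa \<in> hom B (Fo (src A a)) (Fo (tgt A a)) \<and>
      fa G Fa \<cdot>\<^bsub>A\<^esub> e (src A a) = e (tgt A a) \<cdot>\<^bsub>A\<^esub> a" for a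
    using universal_arrD(3)[OF U, of "src A a" "Fo (tgt A a)" "e (tgt A a) \<cdot>\<^bsub>A\<^esub> a"]
      G.cod.src_in[of a] G.cod.tgt_in[of a] G.cod.cmp_in[OF _ e, of a "src A a" "tgt A a"]
    by (auto simp: hom_def)
  then obtain Fa where Fa: "\<And>a. a \<in> Ar A \<Longrightarrow> Fa a \<in> hom B (Fo (src A a)) (Fo (tgt A a))"
      "\<And>a. a \<in> Ar A \<Longrightarrow> fa G (Fa a) \<cdot>\<^bsub>A\<^esub> e (src A a) = e (tgt A a) \<cdot>\<^bsub>A\<^esub> a"
    by metis
  have Fa' [simp]: "Fa a \<in> Ar B" "src B (Fa a) = Fo (src A a)" "tgt B (Fa a) = Fo (tgt A a)"
    if "a \<in> Ar A" for a
    using Fa(1)[OF that] by (auto simp: hom_def)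
  have "\<exists>k. y \<in> Ob B \<longrightarrow> k \<in> hom B (Fo (fo G y)) y \<and> fa G k \<cdot>\<^bsub>A\<^esub> e (fo G y) = idt A (fo G y)" for y
    using universal_arrD(3)[OF U, of "fo G y" y "idt A (fo G y)"] G.cod.idt_in by auto
  then obtain k where k: "\<And>y. y \<in> Ob B \<Longrightarrow> k y \<in> hom B (Fo (fo G y)) y"
      "\<And>y. y \<in> Ob B \<Longrightarrow> fa G (k y) \<cdot>\<^bsub>A\<^esub> e (fo G y) = idt A (fo G y)"
    by metis
  have k' [simp]: "k y \<in> Ar B" "src B (k y) = Fo (fo G y)" "tgt B (k y) = y"
    if "y \<in> Ob B" for y
    using k(1)[OF that] by (auto simp: hom_def)
  let ?F = "\<lparr>fo = Fo, fa = Fa\<rparr>"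
  let ?J = "\<lparr>ladj = ?F, radj = G, unit = e, counit = k\<rparr>"
  have Fun: "is_functor A B ?F"
  proof (unfold_locales, goal_cases)
    case (3 x)
    have "fa G (Fa (idt A x)) \<cdot>\<^bsub>A\<^esub> e x = e x"
      using Fa(2)[of "idt A x"] 3 by simp
    then show ?case
      using uniq[OF 3, of "Fa (idt A x)" "Fo x" "idt B (Fo x)"] 3 by (simp add: hom_def)
  next
    case (4 a x y b z)
    note ty = G.cod.arrI[OF 4(1)] G.cod.arrI[OF 4(2)] G.cod.hom_obs[OF 4(1)] G.cod.hom_obs[OF 4(2)]
    have "fa G (Fa (b \<cdot>\<^bsub>A\<^esub> a)) \<cdot>\<^bsub>A\<^esub> e x = fa G (Fa b \<cdot>\<^bsub>B\<^esub> Fa a) \<cdot>\<^bsub>A\<^esub> e x"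
      using Fa(2)[of a] Fa(2)[of b] Fa(2)[of "b \<cdot>\<^bsub>A\<^esub> a"] ty
        G.cod.reassoc[OF Fa(2)[of b], of a] by simp
    then show ?case
      using uniq[of x "Fa (b \<cdot>\<^bsub>A\<^esub> a)" "Fo z" "Fa b \<cdot>\<^bsub>B\<^esub> Fa a"] ty by (simp add: hom_def)
  qed (auto simp: hom_def)
  interpret F: is_functor A B ?F by (rule Fun)
  have idA: "is_functor A A id_ftor" and idB: "is_functor B B id_ftor"
    by unfold_locales (auto simp: hom_def)
  have nt1: "nat_trans A A id_ftor (G \<odot> ?F) e"
    unfolding nat_trans_def nat_trans_axioms_def
    using idA is_functor_cmp[OF Fun assms(1)] e Fa(2) by (auto simp: hom_def)
  have nat: "k y \<cdot>\<^bsub>B\<^esub> Fa (fa G a) = a \<cdot>\<^bsub>B\<^esub> k x" if a: "a \<in> hom B x y" for a x y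
  proof -
    note ty = G.dom.arrI[OF a] G.dom.hom_obs[OF a]
    have "fa G (k y \<cdot>\<^bsub>B\<^esub> Fa (fa G a)) \<cdot>\<^bsub>A\<^esub> e (fo G x) = fa G (a \<cdot>\<^bsub>B\<^esub> k x) \<cdot>\<^bsub>A\<^esub> e (fo G x)"
      using ty Fa(2)[of "fa G a"] G.cod.reassoc[OF k(2)[of y], of "fa G a"] k(2)[of x] by simp
    then show ?thesis
      using uniq[of "fo G x" "k y \<cdot>\<^bsub>B\<^esub> Fa (fa G a)" y "a \<cdot>\<^bsub>B\<^esub> k x"] ty by (simp add: hom_def)
  qed
  have nt2: "nat_trans B B (?F \<odot> G) id_ftor k"
    unfolding nat_trans_def nat_trans_axioms_def
    using idB is_functor_cmp[OF assms(1) Fun] k nat by auto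
  have tri: "k (Fo x) \<cdot>\<^bsub>B\<^esub> Fa (e x) = idt B (Fo x)" if x: "x \<in> Ob A" for x
  proof -
    have "fa G (k (Fo x) \<cdot>\<^bsub>B\<^esub> Fa (e x)) \<cdot>\<^bsub>A\<^esub> e x = fa G (idt B (Fo x)) \<cdot>\<^bsub>A\<^esub> e x"
      using x Fa(2)[of "e x"] G.cod.reassoc[OF k(2)[of "Fo x"], of "e x"] by simp
    then show ?thesis
      using uniq[of x "k (Fo x) \<cdot>\<^bsub>B\<^esub> Fa (e x)" "Fo x" "idt B (Fo x)"] x by (simp add: hom_def)
  qed
  have "adjunction A B ?J"
    unfolding adjunction_def adjunction_axioms_def
    using Fun assms(1) nt1 nt2 tri k(2) by simp
  then show ?thesis unfolding has_left_adjoint_def by (intro exI[of _ ?J]) simp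
qed

section \<open>Adjoints of composites and of equivalences\<close>

lemma has_left_adjoint_universal:
  "has_left_adjoint A B G \<Longrightarrow> x \<in> Ob A \<Longrightarrow> \<exists>y e. universal_arr A B G x y e"
  unfolding has_left_adjoint_def using adjunction.universal_unit by metis

lemma has_left_adjoint_functor: "has_left_adjoint A B G \<Longrightarrow> is_functor B A G"
  unfolding has_left_adjoint_def adjunction_def by blast

text \<open>Universal arrows paste: \<open>e : x \<rightarrow> G y\<close> followed by
  \<open>G d\<close>, where \<open>d : y \<rightarrow> H z\<close>, is universal for the
  composite.\<close>

lemma has_left_adjoint_cmp:
  assumes G: "has_left_adjoint A B G" and H: "has_left_adjoint B C H"
  shows "has_left_adjoint A C (G \<odot> H)"
proof (rule has_left_adjointI)
  interpret G: is_functor B A G by (rule has_left_adjoint_functor[OF G])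
  interpret H: is_functor C B H by (rule has_left_adjoint_functor[OF H])
  show "is_functor C A (G \<odot> H)"
    by (rule is_functor_cmp) unfold_locales
  fix x assume "x \<in> Ob A"
  then obtain y e where y: "universal_arr A B G x y e"
    using has_left_adjoint_universal[OF G] by blast
  then obtain z d where z: "universal_arr B C H y z d"
    using has_left_adjoint_universal[OF H] universal_arrD(1) by metis
  have e: "e \<in> hom A x (fo G y)" and d: "d \<in> hom B y (fo H z)" and zO: "z \<in> Ob C"
    using universal_arrD(1,2)[OF y] universal_arrD(1,2)[OF z] by auto
  note te = G.cod.arrI[OF e] G.dom.arrI[OF d]
  have "\<exists>!v. v \<in> hom C z w \<and> fa G (fa H v) \<cdot>\<^bsub>A\<^esub> (fa G d \<cdot>\<^bsub>A\<^esub> e) = u"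
    if w: "w \<in> Ob C" and u: "u \<in> hom A x (fo G (fo H w))" for w u
  proof -
    have eq: "fa G (fa H v) \<cdot>\<^bsub>A\<^esub> (fa G d \<cdot>\<^bsub>A\<^esub> e) = fa G (fa H v \<cdot>\<^bsub>B\<^esub> d) \<cdot>\<^bsub>A\<^esub> e"
      if "v \<in> hom C z w" for v
      using te H.dom.arrI[OF that] by simp
    obtain u' where u': "u' \<in> hom B y (fo H w)" "fa G u' \<cdot>\<^bsub>A\<^esub> e = u"
      using universal_arrD(3)[OF y _ u] w by auto
    obtain v where v: "v \<in> hom C z w" "fa H v \<cdot>\<^bsub>B\<^esub> d = u'"
      using universal_arrD(3)[OF z w u'(1)] by auto
    show ?thesis
    proof (rule ex1I[of _ v])
      show "v \<in> hom C z w \<and> fa G (fa H v) \<cdot>\<^bsub>A\<^esub> (fa G d \<cdot>\<^bsub>A\<^esub> e) = u"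
        using v u' eq by auto
      fix v' assume v': "v' \<in> hom C z w \<and> fa G (fa H v') \<cdot>\<^bsub>A\<^esub> (fa G d \<cdot>\<^bsub>A\<^esub> e) = u"
      have "fa H v' \<cdot>\<^bsub>B\<^esub> d = u'"
        using universal_arrD(4)[OF y _ G.dom.cmp_in[OF d H.fa_in, of v' w] u'(1)] v' eq u' u w by auto
      then show "v' = v"
        using universal_arrD(4)[OF z w, of v' v] v v' u' by auto
    qed
  qed
  moreover have "fa G d \<cdot>\<^bsub>A\<^esub> e \<in> hom A x (fo G (fo H z))"
    using G.cod.cmp_in[OF e G.fa_in[OF d]] .
  ultimately have "universal_arr A C (G \<odot> H) x z (fa G d \<cdot>\<^bsub>A\<^esub> e)"
    using zO by (simp add: universal_arr_def)
  then show "\<exists>y e. universal_arr A C (G \<odot> H) x y e" by blast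
qed

lemma has_right_adjoint_cmp:
  "has_right_adjoint B C H \<Longrightarrow> has_right_adjoint A B G \<Longrightarrow> has_right_adjoint A C (H \<odot> G)"
  by (rule has_right_adjoint_op[OF has_left_adjoint_cmp[OF has_left_adjoint_op has_left_adjoint_op]])

text \<open>The two natural isomorphisms of an equivalence are not assumed to satisfy triangle laws.
  Instead the inverse of \<open>\<beta> x\<close> is shown to be a universal arrow, using that
  \<open>F\<close> is full and faithful.\<close>

lemma equivalence_has_left_adjoint:
  assumes "is_equivalence B A F"
  shows "has_left_adjoint A B F"
proof (rule has_left_adjointI)
  obtain G \<alpha> \<beta> where FG: "is_functor B A F" "is_functor A B G"
      and ab: "nat_iso B B (G \<odot> F) id_ftor \<alpha>" "nat_iso A A (F \<odot> G) id_ftor \<beta>"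
    using assms by (auto simp: is_equivalence_def nat_isomorphic_def)
  interpret F: is_functor B A F by fact
  interpret G: is_functor A B G by fact
  interpret \<alpha>: nat_iso B B "G \<odot> F" id_ftor \<alpha> by fact
  interpret \<beta>: nat_iso A A "F \<odot> G" id_ftor \<beta> by fact
  show "is_functor B A F" by fact
  \<comment> \<open>By naturality of \<open>\<alpha>\<close>, the functor \<open>G F\<close> acts on
    arrows as conjugation by the components of \<open>\<alpha>\<close>.\<close>
  have bijF: "bij_betw (\<lambda>a. fa G (fa F a)) (hom B y z) (hom B (fo G (fo F y)) (fo G (fo F z)))"
    if yz: "y \<in> Ob B" "z \<in> Ob B" for y z
  proof -
    obtain h where h: "h \<in> hom B z (fo G (fo F z))" "is_iso B h" "h \<cdot>\<^bsub>B\<^esub> \<alpha> z = idt B (fo G (fo F z))"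
      using F.dom.is_isoE[OF \<alpha>.component_iso \<alpha>.component_in, OF yz(2) yz(2)] by auto
    have "bij_betw (\<lambda>a. h \<cdot>\<^bsub>B\<^esub> (a \<cdot>\<^bsub>B\<^esub> \<alpha> y)) (hom B y z) (hom B (fo G (fo F y)) (fo G (fo F z)))"
      using F.dom.bij_betw_conj[OF \<alpha>.component_in \<alpha>.component_iso h(1,2), OF yz(1) yz(1)] by simp
    moreover have "h \<cdot>\<^bsub>B\<^esub> (a \<cdot>\<^bsub>B\<^esub> \<alpha> y) = fa G (fa F a)" if a: "a \<in> hom B y z" for a
    proof -
      have "a \<cdot>\<^bsub>B\<^esub> \<alpha> y = \<alpha> z \<cdot>\<^bsub>B\<^esub> fa G (fa F a)" using \<alpha>.natural[OF a] by simp
      then show ?thesis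
        using F.dom.reassoc[OF h(3), of "fa G (fa F a)"] F.dom.arrI[OF a] F.dom.arrI[OF h(1)] yz
        by simp
    qed
    ultimately show ?thesis
      using bij_betw_cong[of "hom B y z" "\<lambda>a. h \<cdot>\<^bsub>B\<^esub> (a \<cdot>\<^bsub>B\<^esub> \<alpha> y)" "\<lambda>a. fa G (fa F a)"] by simp
  qed
  have faithful: "a = b" if "y \<in> Ob B" "z \<in> Ob B" "a \<in> hom B y z" "b \<in> hom B y z" "fa F a = fa F b"
    for a b y z
    using bijF[OF that(1,2)] that by (auto simp: bij_betw_def inj_on_def)
  have faithfulG: "a = b" if ab: "a \<in> hom A x x'" "b \<in> hom A x x'" "fa G a = fa G b" for a b x x'
  proof -
    note ty = F.cod.arrI[OF ab(1)] F.cod.arrI[OF ab(2)] F.cod.hom_obs[OF ab(1)]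
    have x: "x \<in> Ob A" using ty by simp
    obtain h where h: "h \<in> hom A x (fo F (fo G x))" "\<beta> x \<cdot>\<^bsub>A\<^esub> h = idt A x"
      using F.cod.is_isoE[OF \<beta>.component_iso[OF x] \<beta>.component_in[OF x]] by auto
    have "a \<cdot>\<^bsub>A\<^esub> \<beta> x = b \<cdot>\<^bsub>A\<^esub> \<beta> x"
      using \<beta>.natural[OF ab(1)] \<beta>.natural[OF ab(2)] ab(3) by simp
    then have "(a \<cdot>\<^bsub>A\<^esub> \<beta> x) \<cdot>\<^bsub>A\<^esub> h = (b \<cdot>\<^bsub>A\<^esub> \<beta> x) \<cdot>\<^bsub>A\<^esub> h" by simp
    then show ?thesis using ty h(2) F.cod.arrI[OF h(1)] by simp
  qed
  \<comment> \<open>Some \<open>a\<close> has the same image under \<open>G F\<close> as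
    \<open>u\<close> has under \<open>G\<close>; faithfulness of \<open>G\<close> then gives
    \<open>F a = u\<close>.\<close>
  have full: "\<exists>a. a \<in> hom B y z \<and> fa F a = u"
    if yz: "y \<in> Ob B" "z \<in> Ob B" and u: "u \<in> hom A (fo F y) (fo F z)" for y z u
  proof -
    have "fa G u \<in> (\<lambda>a. fa G (fa F a)) ` hom B y z"
      using bijF[OF yz] G.fa_in[OF u] by (simp add: bij_betw_def)
    then obtain a where a: "a \<in> hom B y z" "fa G (fa F a) = fa G u" by auto
    then show ?thesis using faithfulG[OF F.fa_in[OF a(1)] u] by auto
  qed
  fix x assume x: "x \<in> Ob A"
  then obtain e where e: "e \<in> hom A x (fo F (fo G x))" "e \<cdot>\<^bsub>A\<^esub> \<beta> x = idt A (fo F (fo G x))"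
      "\<beta> x \<cdot>\<^bsub>A\<^esub> e = idt A x"
    using F.cod.is_isoE[OF \<beta>.component_iso[OF x] \<beta>.component_in[OF x]] by auto
  note te = F.cod.arrI[OF e(1)] x
  have "\<exists>!v. v \<in> hom B (fo G x) z \<and> fa F v \<cdot>\<^bsub>A\<^esub> e = u" if z: "z \<in> Ob B" and u: "u \<in> hom A x (fo F z)" for z u
  proof -
    have "u \<cdot>\<^bsub>A\<^esub> \<beta> x \<in> hom A (fo F (fo G x)) (fo F z)"
      using F.cod.arrI[OF u] x by (simp add: hom_def)
    then obtain v where v: "v \<in> hom B (fo G x) z" "fa F v = u \<cdot>\<^bsub>A\<^esub> \<beta> x"
      using full[of "fo G x" z] x z by auto
    show ?thesis
    proof (rule ex1I[of _ v])
      show "v \<in> hom B (fo G x) z \<and> fa F v \<cdot>\<^bsub>A\<^esub> e = u"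
        using v e te F.cod.arrI[OF u] by simp
      fix w assume w: "w \<in> hom B (fo G x) z \<and> fa F w \<cdot>\<^bsub>A\<^esub> e = u"
      have "(fa F w \<cdot>\<^bsub>A\<^esub> e) \<cdot>\<^bsub>A\<^esub> \<beta> x = fa F w"
        using te e F.dom.arrI[OF conjunct1[OF w]] by simp
      then have "fa F w = fa F v" using w v by simp
      then show "w = v" using faithful[of "fo G x" z w v] v w x z by simp
    qed
  qed
  then have "universal_arr A B F x (fo G x) e"
    using e x by (simp add: universal_arr_def)
  then show "\<exists>y e. universal_arr A B F x y e" by blast
qed

lemma equivalence_has_right_adjoint: "is_equivalence A B F \<Longrightarrow> has_right_adjoint A B F"
  by (rule has_right_adjoint_op[OF equivalence_has_left_adjoint[OF is_equivalence_op]])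


section \<open>Transport of adjoints along a locally fully faithful functor\<close>

text \<open>Full faithfulness localized at one pair of objects, since substitution will be
  controlled only between objects of particular kinds.\<close>

definition bij_at ::
    "('o, 'a) cat \<Rightarrow> ('p, 'b) cat \<Rightarrow> ('o, 'a, 'p, 'b) ftor \<Rightarrow> 'o \<Rightarrow> 'o \<Rightarrow> bool" where
  "bij_at A B F x y \<longleftrightarrow> bij_betw (fa F) (hom A x y) (hom B (fo F x) (fo F y))"

lemma bij_at_op: "bij_at (op_cat A) (op_cat B) F x y = bij_at A B F y x"
  by (simp add: bij_at_def)

text \<open>On arrows \<open>x' \<rightarrow> y'\<close>, \<open>F\<close> is conjugation to arrows
  \<open>x \<rightarrow> y\<close>, then \<open>F\<close>, then conjugation back by the images of
  the isomorphisms; all three are bijective.\<close>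

lemma (in is_functor) bij_at_isomorphic:
  assumes xy: "bij_at A B F x y" and "isomorphic A x x'" "isomorphic A y y'"
  shows "bij_at A B F x' y'"
proof -
  obtain h where h: "h \<in> hom A x x'" "is_iso A h" using assms by (auto simp: isomorphic_def)
  obtain h' where h': "h' \<in> hom A x' x" "is_iso A h'" "h' \<cdot>\<^bsub>A\<^esub> h = idt A x" "h \<cdot>\<^bsub>A\<^esub> h' = idt A x'"
    using dom.is_isoE[OF h(2,1)] by metis
  obtain k' where k': "k' \<in> hom A y y'" "is_iso A k'" using assms by (auto simp: isomorphic_def)
  obtain k where k: "k \<in> hom A y' y" "is_iso A k" "k \<cdot>\<^bsub>A\<^esub> k' = idt A y" "k' \<cdot>\<^bsub>A\<^esub> k = idt A y'"
    using dom.is_isoE[OF k'(2,1)] by metis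
  let ?c = "\<lambda>a. k \<cdot>\<^bsub>A\<^esub> (a \<cdot>\<^bsub>A\<^esub> h)" and ?d = "\<lambda>a. fa F k' \<cdot>\<^bsub>B\<^esub> (a \<cdot>\<^bsub>B\<^esub> fa F h')"
  have "bij_betw (?d \<circ> (fa F \<circ> ?c)) (hom A x' y') (hom B (fo F x') (fo F y'))"
    using dom.bij_betw_conj[OF h k(1,2)] xy[unfolded bij_at_def]
      cod.bij_betw_conj[OF fa_in[OF h'(1)] fa_iso[OF h'(2,1)] fa_in[OF k'(1)] fa_iso[OF k'(2,1)]]
    by (intro bij_betw_trans)
  moreover have "(?d \<circ> (fa F \<circ> ?c)) a = fa F a" if a: "a \<in> hom A x' y'" for a
  proof -
    note ty = dom.arrI[OF a] dom.arrI[OF h(1)] dom.arrI[OF h'(1)] dom.arrI[OF k(1)] dom.arrI[OF k'(1)]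
    have "k' \<cdot>\<^bsub>A\<^esub> ((k \<cdot>\<^bsub>A\<^esub> (a \<cdot>\<^bsub>A\<^esub> h)) \<cdot>\<^bsub>A\<^esub> h') = a"
      using ty h' dom.reassoc[OF k(4), of a] by simp
    then have "fa F (k' \<cdot>\<^bsub>A\<^esub> ((k \<cdot>\<^bsub>A\<^esub> (a \<cdot>\<^bsub>A\<^esub> h)) \<cdot>\<^bsub>A\<^esub> h')) = fa F a"
      by (rule arg_cong)
    then show ?thesis using ty by simp
  qed
  ultimately show ?thesis
    unfolding bij_at_def using bij_betw_cong[of "hom A x' y'" "?d \<circ> (fa F \<circ> ?c)" "fa F"] by blast
qed

text \<open>The comparison at \<open>m\<close> corresponds to the identity of \<open>R (I m)\<close> under the bijections
  \<open>B(b, R (I m)) \<cong> P(U b, I m) \<cong> Q(S (U b), S (I m)) \<cong> Q(U' b, I' m) \<cong> B(b, R' (I' m))\<close>.\<close>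

lemma right_adjoint_transport:
  assumes J: "adjunction B P J" and J': "adjunction B Q J'" and S: "is_functor P Q S"
    and I: "is_functor M P I" and I': "is_functor M Q I'"
    and \<theta>: "nat_isomorphic B Q (ladj J') (S \<odot> ladj J)" and \<kappa>: "nat_isomorphic M Q (S \<odot> I) I'"
    and bij: "\<And>b m. b \<in> Ob B \<Longrightarrow> m \<in> Ob M \<Longrightarrow> bij_at P Q S (fo (ladj J) b) (fo I m)"
  shows "nat_isomorphic M B (radj J \<odot> I) (radj J' \<odot> I')"
proof -
  interpret J: adjunction B P J by fact
  interpret J': adjunction B Q J' by fact
  interpret S: is_functor P Q S by fact
  interpret I: is_functor M P I by fact
  interpret I': is_functor M Q I' by fact
  obtain th where "nat_iso B Q (ladj J') (S \<odot> ladj J) th" using \<theta> by (auto simp: nat_isomorphic_def)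
  then interpret th: nat_iso B Q "ladj J'" "S \<odot> ladj J" th .
  obtain ka where "nat_iso M Q (S \<odot> I) I' ka" using \<kappa> by (auto simp: nat_isomorphic_def)
  then interpret ka: nat_iso M Q "S \<odot> I" I' ka .
  let ?U = "fo (ladj J)" and ?U' = "fo (ladj J')" and ?R = "fo (radj J)" and ?R' = "fo (radj J')"
  \<comment> \<open>\<open>c m : U' (R (I m)) \<rightarrow> I' m\<close> is what the identity of
    \<open>R (I m)\<close> has become before the last transposition; \<open>t m\<close> is its
    transpose along \<open>J'\<close>.\<close>
  define c where "c m = ka m \<cdot>\<^bsub>Q\<^esub> (fa S (counit J (fo I m)) \<cdot>\<^bsub>Q\<^esub> th (?R (fo I m)))" for m
  define t where "t m = fa (radj J') (c m) \<cdot>\<^bsub>B\<^esub> unit J' (?R (fo I m))" for m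
  have c: "c m \<in> Ar Q" "src Q (c m) = ?U' (?R (fo I m))" "tgt Q (c m) = fo I' m" if "m \<in> Ob M" for m
    using that by (auto simp: c_def)
  have t: "t m \<in> hom B (?R (fo I m)) (?R' (fo I' m))" if "m \<in> Ob M" for m
    using that c[OF that] by (auto simp: t_def hom_def)
  have iso: "is_iso B (t m)" if m: "m \<in> Ob M" for m
  proof (rule J.L.dom.iso_if_bij_postcompose[OF t[OF m]])
    fix b assume b: "b \<in> Ob B"
    let ?f1 = "\<lambda>a. counit J (fo I m) \<cdot>\<^bsub>P\<^esub> fa (ladj J) a"
    let ?f3 = "\<lambda>a. ka m \<cdot>\<^bsub>Q\<^esub> (a \<cdot>\<^bsub>Q\<^esub> th b)"
    let ?f4 = "\<lambda>v. fa (radj J') v \<cdot>\<^bsub>B\<^esub> unit J' b"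
    have "bij_betw (?f4 \<circ> (?f3 \<circ> (fa S \<circ> ?f1))) (hom B b (?R (fo I m))) (hom B b (?R' (fo I' m)))"
    proof (intro bij_betw_trans)
      show "bij_betw ?f1 (hom B b (?R (fo I m))) (hom P (?U b) (fo I m))"
        using J.bij_transpose(1) b m by simp
      show "bij_betw (fa S) (hom P (?U b) (fo I m)) (hom Q (fo S (?U b)) (fo S (fo I m)))"
        using bij[OF b m] by (simp add: bij_at_def)
      show "bij_betw ?f3 (hom Q (fo S (?U b)) (fo S (fo I m))) (hom Q (?U' b) (fo I' m))"
        using J'.L.cod.bij_betw_conj[OF th.component_in th.component_iso ka.component_in ka.component_iso,
            of b m, OF b b m m] by simp
      show "bij_betw ?f4 (hom Q (?U' b) (fo I' m)) (hom B b (?R' (fo I' m)))"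
        using J'.bij_transpose(2) b m by simp
    qed
    moreover have "(?f4 \<circ> (?f3 \<circ> (fa S \<circ> ?f1))) a = t m \<cdot>\<^bsub>B\<^esub> a" if a: "a \<in> hom B b (?R (fo I m))" for a
    proof -
      note ty = J.L.dom.arrI[OF a] b m c[OF m]
      have "t m \<cdot>\<^bsub>B\<^esub> a = fa (radj J') (c m) \<cdot>\<^bsub>B\<^esub> (unit J' (?R (fo I m)) \<cdot>\<^bsub>B\<^esub> a)"
        using ty by (simp add: t_def)
      also have "\<dots> = fa (radj J') (c m \<cdot>\<^bsub>Q\<^esub> fa (ladj J') a) \<cdot>\<^bsub>B\<^esub> unit J' b"
        unfolding J'.natural_unit[OF a] using ty by simp
      also have "c m \<cdot>\<^bsub>Q\<^esub> fa (ladj J') a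
          = ka m \<cdot>\<^bsub>Q\<^esub> (fa S (counit J (fo I m)) \<cdot>\<^bsub>Q\<^esub> (th (?R (fo I m)) \<cdot>\<^bsub>Q\<^esub> fa (ladj J') a))"
        using ty by (simp add: c_def)
      also have "\<dots> = ?f3 (fa S (?f1 a))"
        unfolding th.natural[OF a] using ty by simp
      finally show ?thesis by simp
    qed
    ultimately show "bij_betw (\<lambda>a. t m \<cdot>\<^bsub>B\<^esub> a) (hom B b (?R (fo I m))) (hom B b (?R' (fo I' m)))"
      using bij_betw_cong[of "hom B b (?R (fo I m))" "?f4 \<circ> (?f3 \<circ> (fa S \<circ> ?f1))" "\<lambda>a. t m \<cdot>\<^bsub>B\<^esub> a"]
      by blast
  qed
  \<comment> \<open>Naturality of \<open>t\<close> reduces to that of \<open>c\<close>, which uses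
    the naturality of \<open>th\<close>, of the counit of \<open>J\<close> and of \<open>ka\<close>
    in turn.\<close>
  have nat: "t m' \<cdot>\<^bsub>B\<^esub> fa (radj J) (fa I a) = fa (radj J') (fa I' a) \<cdot>\<^bsub>B\<^esub> t m"
    if a: "a \<in> hom M m m'" for a m m'
  proof -
    have m: "m \<in> Ob M" "m' \<in> Ob M" using I.dom.hom_obs[OF a] by auto
    note ty = I.dom.arrI[OF a] m c[OF m(1)] c[OF m(2)]
    let ?a = "fa (radj J) (fa I a)"
    have Ra: "?a \<in> hom B (?R (fo I m)) (?R (fo I m'))"
      using J.R.fa_in I.fa_in a by blast
    have "c m' \<cdot>\<^bsub>Q\<^esub> fa (ladj J') ?a
        = ka m' \<cdot>\<^bsub>Q\<^esub> (fa S (counit J (fo I m')) \<cdot>\<^bsub>Q\<^esub> (th (?R (fo I m')) \<cdot>\<^bsub>Q\<^esub> fa (ladj J') ?a))"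
      using ty by (simp add: c_def)
    also have "\<dots> = ka m' \<cdot>\<^bsub>Q\<^esub> (fa S (counit J (fo I m') \<cdot>\<^bsub>P\<^esub> fa (ladj J) ?a) \<cdot>\<^bsub>Q\<^esub> th (?R (fo I m)))"
      unfolding th.natural[OF Ra] using ty by simp
    also have "\<dots> = (ka m' \<cdot>\<^bsub>Q\<^esub> fa (S \<odot> I) a) \<cdot>\<^bsub>Q\<^esub> (fa S (counit J (fo I m)) \<cdot>\<^bsub>Q\<^esub> th (?R (fo I m)))"
      unfolding J.natural_counit[OF I.fa_in[OF a]] using ty by simp
    also have "\<dots> = fa I' a \<cdot>\<^bsub>Q\<^esub> c m"
      unfolding ka.natural[OF a] using ty by (simp add: c_def)
    finally have ca: "c m' \<cdot>\<^bsub>Q\<^esub> fa (ladj J') ?a = fa I' a \<cdot>\<^bsub>Q\<^esub> c m" .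
    have "t m' \<cdot>\<^bsub>B\<^esub> ?a = fa (radj J') (c m') \<cdot>\<^bsub>B\<^esub> (unit J' (?R (fo I m')) \<cdot>\<^bsub>B\<^esub> ?a)"
      using ty by (simp add: t_def)
    also have "\<dots> = fa (radj J') (c m' \<cdot>\<^bsub>Q\<^esub> fa (ladj J') ?a) \<cdot>\<^bsub>B\<^esub> unit J' (?R (fo I m))"
      unfolding J'.natural_unit[OF Ra] using ty by simp
    also have "\<dots> = fa (radj J') (fa I' a) \<cdot>\<^bsub>B\<^esub> t m"
      unfolding ca using ty by (simp add: t_def)
    finally show ?thesis .
  qed
  have "nat_iso M B (radj J \<odot> I) (radj J' \<odot> I') t"
    by (rule nat_isoI)
      (use t iso nat is_functor_cmp[OF I J.R.is_functor_axioms] is_functor_cmp[OF I' J'.R.is_functor_axioms]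
        in auto)
  then show ?thesis by (auto simp: nat_isomorphic_def)
qed

text \<open>Dual to \<open>right_adjoint_transport\<close> through opposite categories; the
  bijection now concerns arrows from \<open>I m\<close> into values of
  \<open>radj J\<close>.\<close>

lemma left_adjoint_transport:
  assumes J: "adjunction P B J" and J': "adjunction Q B J'" and S: "is_functor P Q S"
    and I: "is_functor M P I" and I': "is_functor M Q I'"
    and \<theta>: "nat_isomorphic B Q (radj J') (S \<odot> radj J)" and \<kappa>: "nat_isomorphic M Q (S \<odot> I) I'"
    and bij: "\<And>b m. b \<in> Ob B \<Longrightarrow> m \<in> Ob M \<Longrightarrow> bij_at P Q S (fo I m) (fo (radj J) b)"
  shows "nat_isomorphic M B (ladj J \<odot> I) (ladj J' \<odot> I')"
proof -
  have "nat_isomorphic (op_cat M) (op_cat B) (radj (op_adj J) \<odot> I) (radj (op_adj J') \<odot> I')"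
    by (rule right_adjoint_transport[OF adjunction_op[OF J] adjunction_op[OF J'] is_functor_op[OF S]
          is_functor_op[OF I] is_functor_op[OF I']])
      (use nat_isomorphic_op[OF \<theta>] nat_isomorphic_op[OF \<kappa>] bij in \<open>auto simp: bij_at_op\<close>)
  then show ?thesis using nat_isomorphic_op by fastforce
qed


section \<open>Products\<close>

context category
begin

lemma product_arrows:
  assumes "\<exists>c. is_product A p q c"
  shows "prd A p q \<in> Ob A" "pr1 A p q \<in> hom A (prd A p q) p" "pr2 A p q \<in> hom A (prd A p q) q"
    and "a \<in> hom A x p \<Longrightarrow> b \<in> hom A x q \<Longrightarrow>
      \<exists>!w. w \<in> hom A x (prd A p q) \<and> pr1 A p q \<cdot>\<^bsub>A\<^esub> w = a \<and> pr2 A p q \<cdot>\<^bsub>A\<^esub> w = b"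
proof -
  have "is_product A p q (product A p q)"
    unfolding product_def using assms by (rule someI_ex)
  then have P: "is_product A p q (prd A p q, pr1 A p q, pr2 A p q)"
    by (simp add: prd_def pr1_def pr2_def)
  show "prd A p q \<in> Ob A" "pr1 A p q \<in> hom A (prd A p q) p" "pr2 A p q \<in> hom A (prd A p q) q"
    using P by (auto simp: is_product_def)
  assume a: "a \<in> hom A x p" "b \<in> hom A x q"
  then show "\<exists>!w. w \<in> hom A x (prd A p q) \<and> pr1 A p q \<cdot>\<^bsub>A\<^esub> w = a \<and> pr2 A p q \<cdot>\<^bsub>A\<^esub> w = b"
    using P hom_obs[OF a(1)] by (auto simp: is_product_def)
qed

lemma pairing_props:
  assumes "\<exists>c. is_product A p q c" "a \<in> hom A x p" "b \<in> hom A x q"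
  shows "pairing A a b \<in> hom A x (prd A p q)"
    and "pr1 A p q \<cdot>\<^bsub>A\<^esub> pairing A a b = a" "pr2 A p q \<cdot>\<^bsub>A\<^esub> pairing A a b = b"
  using theI'[OF product_arrows(4)[OF assms]] arrI[OF assms(2)] arrI[OF assms(3)]
  unfolding pairing_def by auto

text \<open>The inverse pairs the arrow \<open>q \<rightarrow> p\<close> with the identity. The
  composite on the product is the identity because it commutes with both projections, with the first
  one by terminality of \<open>p\<close>.\<close>

lemma pr2_iso_if_terminal:
  assumes "\<exists>c. is_product A p q c" "is_terminal A p" "q \<in> Ob A"
  shows "is_iso A (pr2 A p q)"
proof -
  obtain a where a: "a \<in> hom A q p" using assms by (metis is_terminal_def)
  note pr = product_arrows[OF assms(1)]
  note w = pairing_props[OF assms(1) a idt_in[OF assms(3)]]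
  let ?w = "pairing A a (idt A q)"
  have ww: "?w \<cdot>\<^bsub>A\<^esub> pr2 A p q \<in> hom A (prd A p q) (prd A p q)"
    using cmp_in[OF pr(3) w(1)] .
  have eq1: "pr1 A p q \<cdot>\<^bsub>A\<^esub> (?w \<cdot>\<^bsub>A\<^esub> pr2 A p q) = pr1 A p q"
    using assms(2) pr(1) cmp_in[OF ww pr(2)] pr(2) by (metis is_terminal_def)
  have eq2: "pr2 A p q \<cdot>\<^bsub>A\<^esub> (?w \<cdot>\<^bsub>A\<^esub> pr2 A p q) = pr2 A p q"
    using reassoc[OF w(3), of "pr2 A p q"] arrI[OF w(1)] arrI[OF pr(3)] by simp
  have "?w \<cdot>\<^bsub>A\<^esub> pr2 A p q = idt A (prd A p q)"
    using pr(4)[OF pr(2,3)] ww eq1 eq2 idt_in[OF pr(1)] cmp_idt[OF pr(2)] cmp_idt[OF pr(3)] by metis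
  then show ?thesis using is_isoI[OF pr(3) w(1)] w(3) by simp
qed

end


section \<open>Reflections and terminal objects\<close>

context adjunction
begin

text \<open>Arrows \<open>x \<rightarrow> R t\<close> correspond to arrows
  \<open>L x \<rightarrow> t\<close>, of which there is exactly one.\<close>

lemma radj_terminal:
  assumes t: "is_terminal B t"
  shows "is_terminal A (fo (radj J) t)"
proof -
  have tO: "t \<in> Ob B" using t by (simp add: is_terminal_def)
  have "\<exists>!a. a \<in> hom A x (fo (radj J) t)" if x: "x \<in> Ob A" for x
  proof -
    note b = bij_transpose(2)[OF x tO]
    obtain v where "hom B (fo (ladj J) x) t = {v}"
      using t L.fo_in[OF x] unfolding is_terminal_def by blast
    then have "hom A x (fo (radj J) t) = {fa (radj J) v \<cdot>\<^bsub>A\<^esub> unit J x}"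
      using b by (auto simp: bij_betw_def)
    then show ?thesis by auto
  qed
  then show ?thesis using tO by (simp add: is_terminal_def)
qed

text \<open>The unit \<open>\<eta>\<close> at a terminal object \<open>t\<close> has the retraction \<open>r : R (L t) \<rightarrow> t\<close>; by fullness
  \<open>\<eta> r\<close> is the image of an endomorphism of \<open>L t\<close>, which is the identity since it fixes \<open>\<eta>\<close>.\<close>

lemma ladj_terminal:
  assumes ff: "fully_faithful B A (radj J)" and t: "is_terminal A t"
  shows "is_terminal B (fo (ladj J) t)"
proof -
  have tO: "t \<in> Ob A" using t by (simp add: is_terminal_def)
  let ?L = "fo (ladj J) t"
  have e: "unit J t \<in> hom A t (fo (radj J) ?L)" using unit.component_in[OF tO] by simp
  have LO: "?L \<in> Ob B" using tO by simp
  have bij: "bij_betw (fa (radj J)) (hom B x ?L) (hom A (fo (radj J) x) (fo (radj J) ?L))"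
    if "x \<in> Ob B" for x
    using ff that LO by (simp add: fully_faithful_def)
  obtain r where r: "r \<in> hom A (fo (radj J) ?L) t"
    using t R.fo_in[OF LO] unfolding is_terminal_def by blast
  have re: "r \<cdot>\<^bsub>A\<^esub> unit J t = idt A t"
    using t tO L.dom.cmp_in[OF e r] L.dom.idt_in[OF tO] by (auto simp: is_terminal_def)
  have "unit J t \<cdot>\<^bsub>A\<^esub> r \<in> hom A (fo (radj J) ?L) (fo (radj J) ?L)" using L.dom.cmp_in[OF r e] .
  then obtain v where v: "v \<in> hom B ?L ?L" "fa (radj J) v = unit J t \<cdot>\<^bsub>A\<^esub> r"
    using bij_betw_imp_surj_on[OF bij[OF LO]] by (metis imageE)
  have "fa (radj J) v \<cdot>\<^bsub>A\<^esub> unit J t = fa (radj J) (idt B ?L) \<cdot>\<^bsub>A\<^esub> unit J t"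
    using v re tO L.dom.arrI[OF r] by simp
  then have "v = idt B ?L"
    using universal_arrD(4)[OF universal_unit[OF tO] LO v(1) L.cod.idt_in[OF LO]] e tO
    by (simp add: hom_def)
  then have er: "unit J t \<cdot>\<^bsub>A\<^esub> r = idt A (fo (radj J) ?L)"
    using v(2) LO by simp
  have "isomorphic A (fo (radj J) ?L) t"
    by (rule L.dom.isomorphicI[OF r L.dom.is_isoI[OF r e er re]])
  then have tt: "is_terminal A (fo (radj J) ?L)"
    by (rule L.dom.terminal_if_isomorphic[OF t])
  \<comment> \<open>Full faithfulness of the right adjoint reflects terminality from
    \<open>R (L t)\<close> to \<open>L t\<close>.\<close>
  have "\<exists>!a. a \<in> hom B x ?L" if x: "x \<in> Ob B" for x
  proof -
    obtain a where "hom A (fo (radj J) x) (fo (radj J) ?L) = {a}"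
      using tt R.fo_in[OF x] unfolding is_terminal_def by blast
    then have "fa (radj J) ` hom B x ?L = {a}" "inj_on (fa (radj J)) (hom B x ?L)"
      using bij[OF x] by (simp_all add: bij_betw_def)
    then show ?thesis by (auto dest: inj_onD)
  qed
  then show ?thesis using LO by (simp add: is_terminal_def)
qed

end


section \<open>Substitution along final maps\<close>

text \<open>Transposing along \<open>\<Sigma> \<stileturn> S\<close>, \<open>fa S\<close> on \<open>hom q (i m)\<close> becomes precomposition with the counit,
  which is invertible after applying \<open>\<diamond> \<stileturn> i\<close>.\<close>

lemma bij_at_if_counit_inverted:
  assumes J: "adjunction X Y J" and K: "adjunction Y M K"
    and q: "q \<in> Ob Y" and m: "m \<in> Ob M"
    and iso: "is_iso M (fa (ladj K) (counit J q))"
  shows "bij_at Y X (radj J) q (fo (radj K) m)"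
proof -
  interpret J: adjunction X Y J by fact
  interpret K: adjunction Y M K by fact
  let ?S = "radj J" and ?e = "counit J q" and ?im = "fo (radj K) m"
  let ?Sq = "fo ?S q"
  have e: "?e \<in> hom Y (fo (ladj J) ?Sq) q" using J.counit.component_in[OF q] by simp
  have im: "?im \<in> Ob Y" using m by simp
  obtain d where d: "d \<in> hom M (fo (ladj K) q) (fo (ladj K) (fo (ladj J) ?Sq))" "is_iso M d"
      "d \<cdot>\<^bsub>M\<^esub> fa (ladj K) ?e = idt M (fo (ladj K) (fo (ladj J) ?Sq))"
      "fa (ladj K) ?e \<cdot>\<^bsub>M\<^esub> d = idt M (fo (ladj K) q)"
    using K.L.cod.is_isoE[OF iso K.L.fa_in[OF e]] by metis
  let ?f1 = "\<lambda>a. counit K m \<cdot>\<^bsub>M\<^esub> fa (ladj K) a"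
  \<comment> \<open>The identity on the left only puts precomposition with the image of the counit
    into the form of \<open>bij_betw_conj\<close>.\<close>
  let ?f2 = "\<lambda>a. idt M m \<cdot>\<^bsub>M\<^esub> (a \<cdot>\<^bsub>M\<^esub> fa (ladj K) ?e)"
  let ?f3 = "\<lambda>v. fa (radj K) v \<cdot>\<^bsub>Y\<^esub> unit K (fo (ladj J) ?Sq)"
  let ?f4 = "\<lambda>v. fa ?S v \<cdot>\<^bsub>X\<^esub> unit J ?Sq"
  have "bij_betw (?f4 \<circ> (?f3 \<circ> (?f2 \<circ> ?f1))) (hom Y q ?im) (hom X ?Sq (fo ?S ?im))"
  proof (intro bij_betw_trans)
    show "bij_betw ?f1 (hom Y q ?im) (hom M (fo (ladj K) q) m)"
      by (rule K.bij_transpose(1)[OF q m])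
    show "bij_betw ?f2 (hom M (fo (ladj K) q) m) (hom M (fo (ladj K) (fo (ladj J) ?Sq)) m)"
      by (rule K.L.cod.bij_betw_conj[OF K.L.fa_in[OF e] iso K.L.cod.idt_in[OF m] K.L.cod.iso_idt[OF m]])
    show "bij_betw ?f3 (hom M (fo (ladj K) (fo (ladj J) ?Sq)) m) (hom Y (fo (ladj J) ?Sq) ?im)"
      by (rule K.bij_transpose(2)) (use q m in auto)
    show "bij_betw ?f4 (hom Y (fo (ladj J) ?Sq) ?im) (hom X ?Sq (fo ?S ?im))"
      by (rule J.bij_transpose(2)) (use q im in auto)
  qed
  \<comment> \<open>Transposing along \<open>K\<close> and back leaves \<open>a\<close> after the
    counit of \<open>J\<close>; transposing this along \<open>J\<close> gives \<open>S a\<close> by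
    a triangle law.\<close>
  moreover have "(?f4 \<circ> (?f3 \<circ> (?f2 \<circ> ?f1))) a = fa ?S a" if a: "a \<in> hom Y q ?im" for a
  proof -
    note ty = J.L.cod.arrI[OF a] J.L.cod.arrI[OF e] q m im
    have ae: "a \<cdot>\<^bsub>Y\<^esub> ?e \<in> hom Y (fo (ladj J) ?Sq) ?im" using J.L.cod.cmp_in[OF e a] .
    have "?f3 (?f2 (?f1 a)) = fa (radj K) (counit K m) \<cdot>\<^bsub>Y\<^esub>
        (fa (radj K \<odot> ladj K) (a \<cdot>\<^bsub>Y\<^esub> ?e) \<cdot>\<^bsub>Y\<^esub> unit K (fo (ladj J) ?Sq))"
      using ty by simp
    also have "\<dots> = fa (radj K) (counit K m) \<cdot>\<^bsub>Y\<^esub> (unit K ?im \<cdot>\<^bsub>Y\<^esub> (a \<cdot>\<^bsub>Y\<^esub> ?e))"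
      using K.natural_unit[OF ae] by simp
    also have "\<dots> = a \<cdot>\<^bsub>Y\<^esub> ?e"
      using ty J.L.cod.reassoc[OF K.triangle_right[OF m], of "a \<cdot>\<^bsub>Y\<^esub> ?e"] by simp
    finally have "(?f4 \<circ> (?f3 \<circ> (?f2 \<circ> ?f1))) a = ?f4 (a \<cdot>\<^bsub>Y\<^esub> ?e)" by simp
    also have "\<dots> = fa ?S a"
      using ty J.triangle_right[OF q] by simp
    finally show ?thesis .
  qed
  ultimately show ?thesis
    unfolding bij_at_def
    using bij_betw_cong[of "hom Y q ?im" "?f4 \<circ> (?f3 \<circ> (?f2 \<circ> ?f1))" "fa ?S"] by blast
qed


text \<open>Write \<open>L\<close> for \<open>ladj J\<close>. The counit after \<open>L\<close> of
  the projection \<open>p \<times> S q \<rightarrow> S q\<close> equals the Frobenius arrow followed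
  by the projection \<open>L p \<times> q \<rightarrow> q\<close>. That projection factors through
  \<open>?tt \<times> q\<close> by the unit of \<open>K\<close> times the identity, which
  \<open>ladj K\<close> inverts by \<open>mixed\<close>; the remaining projection is invertible
  because \<open>?tt\<close> is terminal.\<close>

lemma counit_inverted_if_terminal:
  assumes J: "adjunction X Y J" and K: "adjunction Y M K"
    and prodX: "\<exists>c. is_product X p (fo (radj J) q) c"
    and prodY: "\<And>r. r \<in> Ob Y \<Longrightarrow> \<exists>c. is_product Y r q c"
    and p: "is_terminal X p" and q: "q \<in> Ob Y"
    and tm: "is_terminal M (fo (ladj K) (fo (ladj J) p))"
    and frob: "is_iso Y (pairing Y (fa (ladj J) (pr1 X p (fo (radj J) q)))
      (left_transpose Y J q (pr2 X p (fo (radj J) q))))"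
    and mixed: "is_iso M (fa (ladj K) (prd_arr Y (unit K (fo (ladj J) p)) (idt Y q)))"
  shows "is_iso M (fa (ladj K) (counit J q))"
proof -
  interpret J: adjunction X Y J by fact
  interpret K: adjunction Y M K by fact
  let ?Sq = "fo (radj J) q" and ?Lp = "fo (ladj J) p"
  let ?tt = "fo (radj K) (fo (ladj K) ?Lp)"
  have pO: "p \<in> Ob X" using p by (simp add: is_terminal_def)
  have LpO: "?Lp \<in> Ob Y" and SqO: "?Sq \<in> Ob X" and ttO: "?tt \<in> Ob Y" using pO q by auto
  note prX = J.L.dom.product_arrows(1-3)[OF prodX]
  note prY = J.L.cod.product_arrows(1-3)[OF prodY[OF LpO]]
  note prT = J.L.cod.product_arrows(1-3)[OF prodY[OF ttO]]
  have e: "counit J q \<in> hom Y (fo (ladj J) ?Sq) q" using J.counit.component_in[OF q] by simp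
  let ?pr = "fa (ladj J) (pr2 X p ?Sq)"
  have pr_in: "?pr \<in> hom Y (fo (ladj J) (prd X p ?Sq)) (fo (ladj J) ?Sq)"
    by (rule J.L.fa_in[OF prX(3)])
  have pr_iso: "is_iso Y ?pr"
    by (rule J.L.fa_iso[OF J.L.dom.pr2_iso_if_terminal[OF prodX p SqO] prX(3)])
  let ?c = "counit J q \<cdot>\<^bsub>Y\<^esub> ?pr"
  note c_in = J.L.cod.cmp_in[OF pr_in e]
  note fr = J.L.cod.pairing_props[OF prodY[OF LpO] J.L.fa_in[OF prX(2)] c_in]
  let ?fr = "pairing Y (fa (ladj J) (pr1 X p ?Sq)) ?c"
  have fr_iso: "is_iso Y ?fr" using frob by (simp add: left_transpose_def)
  let ?u = "prd_arr Y (unit K ?Lp) (idt Y q)"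
  have \<eta>: "unit K ?Lp \<in> hom Y ?Lp ?tt" using K.unit.component_in[OF LpO] by simp
  have u_eq: "?u = pairing Y (unit K ?Lp \<cdot>\<^bsub>Y\<^esub> pr1 Y ?Lp q) (pr2 Y ?Lp q)"
    using J.L.cod.arrI[OF \<eta>] J.L.cod.arrI[OF prY(3)] q by (simp add: prd_arr_def)
  note u = J.L.cod.pairing_props[OF prodY[OF ttO] J.L.cod.cmp_in[OF prY(2) \<eta>] prY(3), folded u_eq]
  have prT_iso: "is_iso Y (pr2 Y ?tt q)"
    using J.L.cod.pr2_iso_if_terminal[OF prodY[OF ttO] K.radj_terminal[OF tm] q] .
  have "is_iso M (fa (ladj K) (pr2 Y ?tt q) \<cdot>\<^bsub>M\<^esub> fa (ladj K) ?u)"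
    by (rule K.L.cod.iso_cmp[OF mixed K.L.fa_iso[OF prT_iso prT(3)] K.L.fa_in[OF u(1)] K.L.fa_in[OF prT(3)]])
  then have "is_iso M (fa (ladj K) (pr2 Y ?Lp q))"
    using K.L.fa_cmp[OF u(1) prT(3)] u(3) by simp
  then have "is_iso M (fa (ladj K) (pr2 Y ?Lp q) \<cdot>\<^bsub>M\<^esub> fa (ladj K) ?fr)"
    using K.L.cod.iso_cmp[OF K.L.fa_iso[OF fr_iso fr(1)] _ K.L.fa_in[OF fr(1)] K.L.fa_in[OF prY(3)]] by simp
  then have "is_iso M (fa (ladj K) ?c)"
    using K.L.fa_cmp[OF fr(1) prY(3)] fr(3) by simp
  then have "is_iso M (fa (ladj K) (counit J q) \<cdot>\<^bsub>M\<^esub> fa (ladj K) ?pr)"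
    using K.L.fa_cmp[OF pr_in e] by simp
  \<comment> \<open>The projection from \<open>p \<times> S q\<close> is invertible since
    \<open>p\<close> is terminal, so its image can be cancelled.\<close>
  then show ?thesis
    using K.L.cod.iso_cancel_right[OF K.L.fa_iso[OF pr_iso pr_in] _ K.L.fa_in[OF pr_in] K.L.fa_in[OF e]]
    by simp
qed

text \<open>Finality speaks of the terminal object of \<open>L\<close>, whereas the Frobenius
  argument starts from that of \<open>X\<close>. The two agree because \<open>radj H\<close>
  preserves terminal objects; those of \<open>L\<close> and \<open>M\<close> exist as reflections of
  the ones in \<open>X\<close> and \<open>Y\<close>.\<close>

lemma terminal_preserved_if_final:
  assumes J: "adjunction X Y J" and K: "adjunction Y M K" and H: "adjunction X L H"
    and ffK: "fully_faithful M Y (radj K)" and ffH: "fully_faithful L X (radj H)"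
    and X: "\<exists>t. is_terminal X t" and Y: "\<exists>t. is_terminal Y t"
    and fin: "isomorphic M (fo (ladj K) (fo (ladj J) (fo (radj H) (terminal L)))) (terminal M)"
  shows "is_terminal M (fo (ladj K) (fo (ladj J) (terminal X)))"
proof -
  interpret J: adjunction X Y J by fact
  interpret K: adjunction Y M K by fact
  interpret H: adjunction X L H by fact
  have tL: "is_terminal L (terminal L)"
    using H.L.cod.terminal_is_terminal H.ladj_terminal[OF ffH] X by blast
  have tM: "is_terminal M (terminal M)"
    using K.L.cod.terminal_is_terminal K.ladj_terminal[OF ffK] Y by blast
  have "isomorphic X (terminal X) (fo (radj H) (terminal L))"
    by (rule J.L.dom.terminal_isomorphic[OF J.L.dom.terminal_is_terminal[OF X] H.radj_terminal[OF tL]])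
  then have "isomorphic M (fo (ladj K) (fo (ladj J) (terminal X)))
      (fo (ladj K) (fo (ladj J) (fo (radj H) (terminal L))))"
    by (intro K.L.isomorphic_fo J.L.isomorphic_fo)
  then show ?thesis
    using K.L.cod.terminal_if_isomorphic[OF tM] K.L.cod.isomorphic_trans fin by blast
qed


section \<open>Temporal doctrines\<close>

lemma left_adjunction_props:
  assumes "has_left_adjoint A B G"
  shows "adjunction A B (left_adjunction A B G)" "radj (left_adjunction A B G) = G"
  using someI_ex[of "\<lambda>J. adjunction A B J \<and> radj J = G"] assms
  unfolding has_left_adjoint_def left_adjunction_def by auto

lemma right_adjunction_props:
  assumes "has_right_adjoint A B F"
  shows "adjunction A B (right_adjunction A B F)" "ladj (right_adjunction A B F) = F"
  using someI_ex[of "\<lambda>J. adjunction A B J \<and> ladj J = F"] assms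
  unfolding has_right_adjoint_def right_adjunction_def by auto

lemma nat_iso_whisker:
  assumes "nat_iso A B F G t" "is_functor C A H"
  shows "nat_iso C B (F \<odot> H) (G \<odot> H) (\<lambda>x. t (fo H x))"
proof -
  interpret nat_iso A B F G t by fact
  interpret H: is_functor C A H by fact
  show ?thesis
    by (rule nat_isoI)
      (auto simp: component_iso intro!: is_functor_cmp F.is_functor_axioms G.is_functor_axioms
        H.is_functor_axioms component_in[of "fo H _", simplified] natural H.fa_in)
qed

section \<open>Chosen adjunctions and bijectivity of substitution\<close>

context temporal_doctrine
begin

lemma hom_obs: "f \<in> hom (CC D) X Y \<Longrightarrow> X \<in> Ob (CC D) \<and> Y \<in> Ob (CC D)"
  by (rule i.dom.base.hom_obs)

lemma Sigma_adj_props: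
  assumes "f \<in> hom (CC D) X Y"
  shows "adjunction (fib (PP D) X) (fib (PP D) Y) (Sigma_adj D f)" "radj (Sigma_adj D f) = sub (PP D) f"
  using left_adjunction_props[OF A3_left[OF assms]] i.dom.base.arrI[OF assms]
  by (auto simp: Sigma_adj_def)

lemma Dia_adj_props:
  assumes "X \<in> Ob (CC D)"
  shows "adjunction (fib (PP D) X) (fib (MM D) X) (Dia_adj D X)" "radj (Dia_adj D X) = fn (ii D) X"
  using left_adjunction_props[OF A4_left[OF assms]] by (auto simp: Dia_adj_def)

lemma Dia'_adj_props:
  assumes "X \<in> Ob (CC D)"
  shows "adjunction (fib (PP D) X) (fib (MM' D) X) (Dia'_adj D X)" "radj (Dia'_adj D X) = fn (ii' D) X"
  using left_adjunction_props[OF A4'_left[OF assms]] by (auto simp: Dia'_adj_def)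

lemma frobenius_iso:
  assumes f: "f \<in> hom (CC D) X Y" and q: "q \<in> Ob (fib (PP D) Y)"
    and p: "p \<in> Ob (fib (PP D) X)"
  shows "is_iso (fib (PP D) Y)
    (pairing (fib (PP D) Y) (fa (ladj (Sigma_adj D f)) (pr1 (fib (PP D) X) p (fo (radj (Sigma_adj D f)) q)))
      (left_transpose (fib (PP D) Y) (Sigma_adj D f) q (pr2 (fib (PP D) X) p (fo (radj (Sigma_adj D f)) q))))"
  using B2[OF f p q] i.dom.base.arrI[OF f] Sigma_adj_props(2)[OF f]
  by (simp add: frobenius_arr_def Let_def)

text \<open>The reflections \<open>K\<close> and \<open>H\<close> are left abstract so that both
  \<open>Dia_adj\<close> (final maps) and \<open>Dia'_adj\<close> (initial maps) are
  instances.\<close>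

lemma bij_at_if_reflection_inverts:
  assumes f: "f \<in> hom (CC D) X Y" and q: "q \<in> Ob (fib (PP D) Y)" and m: "m \<in> Ob M"
    and K: "adjunction (fib (PP D) Y) M K" and H: "adjunction (fib (PP D) X) L H"
    and ff: "fully_faithful M (fib (PP D) Y) (radj K)" "fully_faithful L (fib (PP D) X) (radj H)"
    and fin: "isomorphic M (fo (ladj K) (fo (ladj (Sigma_adj D f)) (fo (radj H) (terminal L)))) (terminal M)"
    and mixed: "\<And>p. p \<in> Ob (fib (PP D) Y) \<Longrightarrow>
      is_iso M (fa (ladj K) (prd_arr (fib (PP D) Y) (unit K p) (idt (fib (PP D) Y) q)))"
  shows "bij_at (fib (PP D) Y) (fib (PP D) X) (sub (PP D) f) q (fo (radj K) m)"
proof -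
  note O = conjunct1[OF hom_obs[OF f]] conjunct2[OF hom_obs[OF f]]
  note \<Sigma> = Sigma_adj_props[OF f]
  interpret PX: cartesian_closed "fib (PP D) X" by (rule A2[OF O(1)])
  interpret PY: cartesian_closed "fib (PP D) Y" by (rule A2[OF O(2)])
  interpret \<Sigma>: adjunction "fib (PP D) X" "fib (PP D) Y" "Sigma_adj D f" by (rule \<Sigma>(1))
  have t: "is_terminal (fib (PP D) X) (terminal (fib (PP D) X))"
    by (rule PX.terminal_is_terminal[OF PX.has_terminal])
  then have tO: "terminal (fib (PP D) X) \<in> Ob (fib (PP D) X)" by (simp add: is_terminal_def)
  have "is_iso M (fa (ladj K) (counit (Sigma_adj D f) q))"
    by (rule counit_inverted_if_terminal[OF \<Sigma>(1) K PX.has_product PY.has_product t q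
          terminal_preserved_if_final[OF \<Sigma>(1) K H ff PX.has_terminal PY.has_terminal fin]
          frobenius_iso[OF f q tO] mixed])
      (use tO q in auto)
  then show ?thesis
    using bij_at_if_counit_inverted[OF \<Sigma>(1) K q m] \<Sigma>(2) by simp
qed

text \<open>Here \<open>q\<close> is \<open>i' n\<close>, the kind of object for which
  \<open>B3\<close> supplies the mixed Frobenius law of \<open>Dia_adj\<close>.\<close>

lemma final_bij_at:
  assumes f: "f \<in> hom (CC D) X Y" and fin: "final D f"
    and m: "m \<in> Ob (fib (MM D) Y)" and n: "n \<in> Ob (fib (MM' D) Y)"
  shows "bij_at (fib (PP D) Y) (fib (PP D) X) (sub (PP D) f) (fo (fn (ii' D) Y) n) (fo (fn (ii D) Y) m)"
proof -
  note O = conjunct1[OF hom_obs[OF f]] conjunct2[OF hom_obs[OF f]]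
  note K = Dia_adj_props[OF O(2)] and H = Dia_adj_props[OF O(1)]
  interpret i'Y: is_functor "fib (MM' D) Y" "fib (PP D) Y" "fn (ii' D) Y" by (rule i'.fn_functor[OF O(2)])
  have fin': "isomorphic (fib (MM D) Y) (fo (ladj (Dia_adj D Y)) (fo (ladj (Sigma_adj D f))
      (fo (radj (Dia_adj D X)) (terminal (fib (MM D) X))))) (terminal (fib (MM D) Y))"
    using fin i.dom.base.arrI[OF f] H(2) by (simp add: final_def Ex_ftor_def)
  show ?thesis
    using bij_at_if_reflection_inverts[OF f i'Y.fo_in[OF n] m K(1) H(1) _ _ fin'] B1[OF O(1)] B1[OF O(2)]
      B3[OF O(2) _ n] K(2) H(2) by simp
qed

lemma initial_bij_at:
  assumes f: "f \<in> hom (CC D) X Y" and init: "initial D f"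
    and m: "m \<in> Ob (fib (MM D) Y)" and n: "n \<in> Ob (fib (MM' D) Y)"
  shows "bij_at (fib (PP D) Y) (fib (PP D) X) (sub (PP D) f) (fo (fn (ii D) Y) m) (fo (fn (ii' D) Y) n)"
proof -
  note O = conjunct1[OF hom_obs[OF f]] conjunct2[OF hom_obs[OF f]]
  note K = Dia'_adj_props[OF O(2)] and H = Dia'_adj_props[OF O(1)]
  interpret iY: is_functor "fib (MM D) Y" "fib (PP D) Y" "fn (ii D) Y" by (rule i.fn_functor[OF O(2)])
  have init': "isomorphic (fib (MM' D) Y) (fo (ladj (Dia'_adj D Y)) (fo (ladj (Sigma_adj D f))
      (fo (radj (Dia'_adj D X)) (terminal (fib (MM' D) X))))) (terminal (fib (MM' D) Y))"
    using init i.dom.base.arrI[OF f] H(2) by (simp add: initial_def Ex'_ftor_def)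
  show ?thesis
    using bij_at_if_reflection_inverts[OF f iY.fo_in[OF m] n K(1) H(1) _ _ init'] B1'[OF O(1)] B1'[OF O(2)]
      B3'[OF O(2) _ m] K(2) H(2) by simp
qed

section \<open>Constant objects\<close>

lemma terminal_in: "X \<in> Ob (CC D) \<Longrightarrow> to_terminal (CC D) X \<in> hom (CC D) X (terminal (CC D))"
  by (rule i.dom.base.to_terminal_in[OF A1])

lemma terminal_Ob: "terminal (CC D) \<in> Ob (CC D)"
  using i.dom.base.terminal_is_terminal[OF A1] by (simp add: is_terminal_def)

text \<open>Each factor of \<open>const\<close> has a left adjoint, \<open>pb_fst\<close> because it
  is an equivalence at the terminal object. This ensures that the choice in \<open>Coend\<close> is
  an actual adjunction.\<close>

lemma const_has_left_adjoint:
  assumes "X \<in> Ob (CC D)"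
  shows "has_left_adjoint (fib (PP D) X) (BB1 D) (const D X)"
  unfolding const_def bb_def BB1_def
  by (rule has_left_adjoint_cmp[OF A3_left[OF terminal_in[OF assms]]
        has_left_adjoint_cmp[OF A4_left[OF terminal_Ob] equivalence_has_left_adjoint[OF B4]]])

lemma const_has_right_adjoint:
  assumes "X \<in> Ob (CC D)"
  shows "has_right_adjoint (BB1 D) (fib (PP D) X) (const D X)"
  unfolding const_def bb_def BB1_def
  by (rule has_right_adjoint_cmp[OF A3_right[OF terminal_in[OF assms]]
        has_right_adjoint_cmp[OF A4_right[OF terminal_Ob] equivalence_has_right_adjoint[OF B4]]])

text \<open>The map from \<open>Y\<close> to the terminal object composed with \<open>f\<close> is
  the one from \<open>X\<close>, so \<open>scmp\<close>, restricted along \<open>bb\<close>,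
  compares the two constants.\<close>

lemma const_sub:
  assumes f: "f \<in> hom (CC D) X Y"
  shows "nat_isomorphic (BB1 D) (fib (PP D) X) (sub (PP D) f \<odot> const D Y) (const D X)"
proof -
  note O = conjunct1[OF hom_obs[OF f]] conjunct2[OF hom_obs[OF f]]
  have "is_functor (BB1 D) (fib (MM D) (terminal (CC D))) pb_fst"
    using B4 by (simp add: is_equivalence_def BB1_def)
  then have bb: "is_functor (BB1 D) (fib (PP D) (terminal (CC D))) (bb D (terminal (CC D)))"
    unfolding bb_def by (rule is_functor_cmp[OF _ i.fn_functor[OF terminal_Ob]])
  have eq: "to_terminal (CC D) Y \<cdot>\<^bsub>CC D\<^esub> f = to_terminal (CC D) X"
    by (rule i.dom.base.to_terminal_eq[OF A1 i.dom.base.cmp_in[OF f terminal_in[OF O(2)]]])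
  show ?thesis
    using nat_iso_whisker[OF i.cod.scmp_iso[OF f terminal_in[OF O(2)]] bb]
    unfolding nat_isomorphic_def const_def eq cmp_ftor_assoc by blast
qed

text \<open>An object of \<open>BB1 D\<close> carries an isomorphism
  \<open>\<phi> : i x \<rightarrow> i' y\<close>. Substituting it along
  \<open>Y \<rightarrow> 1\<close> and using the cells of \<open>i\<close> and \<open>i'\<close>
  presents the constant object in both ways.\<close>

lemma const_in_image:
  assumes Y: "Y \<in> Ob (CC D)" and b: "b \<in> Ob (BB1 D)"
  shows "\<exists>m \<in> Ob (fib (MM D) Y). isomorphic (fib (PP D) Y) (fo (fn (ii D) Y) m) (fo (const D Y) b)"
    and "\<exists>n \<in> Ob (fib (MM' D) Y). isomorphic (fib (PP D) Y) (fo (fn (ii' D) Y) n) (fo (const D Y) b)"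
proof -
  let ?i1 = "terminal (CC D)" and ?t = "to_terminal (CC D) Y"
  obtain x y \<phi> where xy: "b = (x, y, \<phi>)" "x \<in> Ob (fib (MM D) ?i1)" "y \<in> Ob (fib (MM' D) ?i1)"
      "\<phi> \<in> hom (fib (PP D) ?i1) (fo (fn (ii D) ?i1) x) (fo (fn (ii' D) ?i1) y)" "is_iso (fib (PP D) ?i1) \<phi>"
    using b by (auto simp: BB1_def BB_def pullback_def Let_def)
  note t = terminal_in[OF Y]
  interpret S: is_functor "fib (PP D) ?i1" "fib (PP D) Y" "sub (PP D) ?t" by (rule i.cod.sub_functor[OF t])
  interpret cell: nat_iso "fib (MM D) ?i1" "fib (PP D) Y" "fn (ii D) Y \<odot> sub (MM D) ?t"
    "sub (PP D) ?t \<odot> fn (ii D) ?i1" "cell (ii D) ?t" by (rule i.cell_iso[OF t])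
  interpret cell': nat_iso "fib (MM' D) ?i1" "fib (PP D) Y" "fn (ii' D) Y \<odot> sub (MM' D) ?t"
    "sub (PP D) ?t \<odot> fn (ii' D) ?i1" "cell (ii' D) ?t" by (rule i'.cell_iso[OF t])
  have const: "fo (const D Y) b = fo (sub (PP D) ?t) (fo (fn (ii D) ?i1) x)"
    by (simp add: const_def bb_def pb_fst_def xy(1))
  have "isomorphic (fib (PP D) Y) (fo (fn (ii D) Y) (fo (sub (MM D) ?t) x)) (fo (const D Y) b)"
    using S.cod.isomorphicI[OF cell.component_in cell.component_iso, OF xy(2) xy(2)] const by simp
  then show "\<exists>m \<in> Ob (fib (MM D) Y). isomorphic (fib (PP D) Y) (fo (fn (ii D) Y) m) (fo (const D Y) b)"
    using is_functor.fo_in[OF i.dom.sub_functor[OF t] xy(2)] by blast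
  have "isomorphic (fib (PP D) Y) (fo (const D Y) b) (fo (sub (PP D) ?t) (fo (fn (ii' D) ?i1) y))"
    unfolding const by (rule S.isomorphic_fo[OF S.dom.isomorphicI[OF xy(4,5)]])
  then have "isomorphic (fib (PP D) Y) (fo (fn (ii' D) Y) (fo (sub (MM' D) ?t) y)) (fo (const D Y) b)"
    using S.cod.isomorphic_trans[OF S.cod.isomorphicI[OF cell'.component_in cell'.component_iso,
        OF xy(3) xy(3)] S.cod.isomorphic_sym] by simp
  then show "\<exists>n \<in> Ob (fib (MM' D) Y). isomorphic (fib (PP D) Y) (fo (fn (ii' D) Y) n) (fo (const D Y) b)"
    using is_functor.fo_in[OF i'.dom.sub_functor[OF t] xy(3)] by blast
qed

section \<open>Transport of ends and coends\<close>

lemma isomorphic_refl: "Y \<in> Ob (CC D) \<Longrightarrow> p \<in> Ob (fib (PP D) Y) \<Longrightarrow> isomorphic (fib (PP D) Y) p p"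
  using category.isomorphicI category.idt_in category.iso_idt i.cod.fib_category by metis

text \<open>Arrows from constants into \<open>I m\<close> are cones, and substitution matches those
  over \<open>Y\<close> with those over \<open>X\<close>. The transport lemma compares in the
  direction from \<open>Y\<close> to \<open>X\<close>, hence the symmetry.\<close>

lemma end_transport:
  assumes f: "f \<in> hom (CC D) X Y"
    and I: "is_functor M (fib (PP D) Y) I" and I': "is_functor M (fib (PP D) X) I'"
    and cell: "nat_isomorphic M (fib (PP D) X) I' (sub (PP D) f \<odot> I)"
    and bij: "\<And>b m. b \<in> Ob (BB1 D) \<Longrightarrow> m \<in> Ob M \<Longrightarrow>
      bij_at (fib (PP D) Y) (fib (PP D) X) (sub (PP D) f) (fo (const D Y) b) (fo I m)"
  shows "nat_isomorphic M (BB1 D) (End D X \<odot> I') (End D Y \<odot> I)"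
proof -
  note O = conjunct1[OF hom_obs[OF f]] conjunct2[OF hom_obs[OF f]]
  note a = right_adjunction_props[OF const_has_right_adjoint[OF O(1)]]
    right_adjunction_props[OF const_has_right_adjoint[OF O(2)]]
  show ?thesis
    unfolding End_def
    by (rule nat_isomorphic_sym, rule right_adjoint_transport[OF a(3) a(1) i.cod.sub_functor[OF f] I I'])
      (use bij in \<open>auto simp: a(2,4) intro!: nat_isomorphic_sym[OF const_sub[OF f]] nat_isomorphic_sym[OF cell]\<close>)
qed

lemma coend_transport:
  assumes f: "f \<in> hom (CC D) X Y"
    and I: "is_functor M (fib (PP D) Y) I" and I': "is_functor M (fib (PP D) X) I'"
    and cell: "nat_isomorphic M (fib (PP D) X) I' (sub (PP D) f \<odot> I)"
    and bij: "\<And>b m. b \<in> Ob (BB1 D) \<Longrightarrow> m \<in> Ob M \<Longrightarrow>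
      bij_at (fib (PP D) Y) (fib (PP D) X) (sub (PP D) f) (fo I m) (fo (const D Y) b)"
  shows "nat_isomorphic M (BB1 D) (Coend D X \<odot> I') (Coend D Y \<odot> I)"
proof -
  note O = conjunct1[OF hom_obs[OF f]] conjunct2[OF hom_obs[OF f]]
  note a = left_adjunction_props[OF const_has_left_adjoint[OF O(1)]]
    left_adjunction_props[OF const_has_left_adjoint[OF O(2)]]
  show ?thesis
    unfolding Coend_def
    by (rule nat_isomorphic_sym, rule left_adjoint_transport[OF a(3) a(1) i.cod.sub_functor[OF f] I I'])
      (use bij in \<open>auto simp: a(2,4) intro!: nat_isomorphic_sym[OF const_sub[OF f]] nat_isomorphic_sym[OF cell]\<close>)
qed

end

section \<open>Invariance of limits and colimits under final and initial maps\<close>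

theorem corollary7p1:
  fixes D :: "('o, 'a, 'm, 'c, 'p, 'b, 'n, 'd) doctrine"
  assumes "temporal_doctrine D"
    and "f \<in> hom (CC D) X Y"
  shows "(final D f \<longrightarrow>
      nat_isomorphic (fib (MM D) Y) (BB1 D) (Lim D X \<odot> sub (MM D) f) (Lim D Y) \<and>
      nat_isomorphic (fib (MM' D) Y) (BB1 D) (Colim' D X \<odot> sub (MM' D) f) (Colim' D Y)) \<and>
    (initial D f \<longrightarrow>
      nat_isomorphic (fib (MM D) Y) (BB1 D) (Colim D X \<odot> sub (MM D) f) (Colim D Y) \<and>
      nat_isomorphic (fib (MM' D) Y) (BB1 D) (Lim' D X \<odot> sub (MM' D) f) (Lim' D Y))"
proof -
  interpret temporal_doctrine D by fact
  note f = assms(2)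
  note O = conjunct1[OF hom_obs[OF f]] conjunct2[OF hom_obs[OF f]]
  interpret S: is_functor "fib (PP D) Y" "fib (PP D) X" "sub (PP D) f" by (rule i.cod.sub_functor[OF f])
  note iY = i.fn_functor[OF O(2)] and i'Y = i'.fn_functor[OF O(2)]
  note iX = is_functor_cmp[OF i.dom.sub_functor[OF f] i.fn_functor[OF O(1)]]
    and i'X = is_functor_cmp[OF i'.dom.sub_functor[OF f] i'.fn_functor[OF O(1)]]
  have cell: "nat_isomorphic (fib (MM D) Y) (fib (PP D) X)
      (fn (ii D) X \<odot> sub (MM D) f) (sub (PP D) f \<odot> fn (ii D) Y)"
    and cell': "nat_isomorphic (fib (MM' D) Y) (fib (PP D) X)
      (fn (ii' D) X \<odot> sub (MM' D) f) (sub (PP D) f \<odot> fn (ii' D) Y)"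
    using i.cell_iso[OF f] i'.cell_iso[OF f] by (auto simp: nat_isomorphic_def)
  note refl = isomorphic_refl[OF O(2) is_functor.fo_in[OF iY]] isomorphic_refl[OF O(2) is_functor.fo_in[OF i'Y]]
  have "nat_isomorphic (fib (MM D) Y) (BB1 D) (Lim D X \<odot> sub (MM D) f) (Lim D Y)" if "final D f"
    unfolding Lim_def cmp_ftor_assoc
  proof (rule end_transport[OF f iY iX cell])
    fix b m assume b: "b \<in> Ob (BB1 D)" and m: "m \<in> Ob (fib (MM D) Y)"
    \<comment> \<open>Final maps control arrows from \<open>i' n\<close> to \<open>i m\<close>; a
      cone has its constant as source, so the constant is presented as \<open>i' n\<close>.\<close>
    obtain n where n: "n \<in> Ob (fib (MM' D) Y)" "isomorphic (fib (PP D) Y) (fo (fn (ii' D) Y) n) (fo (const D Y) b)"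
      using const_in_image(2)[OF O(2) b] by blast
    show "bij_at (fib (PP D) Y) (fib (PP D) X) (sub (PP D) f) (fo (const D Y) b) (fo (fn (ii D) Y) m)"
      by (rule S.bij_at_isomorphic[OF final_bij_at[OF f that m n(1)] n(2) refl(1)[OF m]])
  qed
  moreover have "nat_isomorphic (fib (MM' D) Y) (BB1 D) (Colim' D X \<odot> sub (MM' D) f) (Colim' D Y)" if "final D f"
    unfolding Colim'_def cmp_ftor_assoc
  proof (rule coend_transport[OF f i'Y i'X cell'])
    fix b n assume b: "b \<in> Ob (BB1 D)" and n: "n \<in> Ob (fib (MM' D) Y)"
    \<comment> \<open>For a cocone under \<open>i' n\<close> the constant is the target, so it is
      presented as \<open>i m\<close>.\<close>
    obtain m where m: "m \<in> Ob (fib (MM D) Y)" "isomorphic (fib (PP D) Y) (fo (fn (ii D) Y) m) (fo (const D Y) b)"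
      using const_in_image(1)[OF O(2) b] by blast
    show "bij_at (fib (PP D) Y) (fib (PP D) X) (sub (PP D) f) (fo (fn (ii' D) Y) n) (fo (const D Y) b)"
      by (rule S.bij_at_isomorphic[OF final_bij_at[OF f that m(1) n] refl(2)[OF n] m(2)])
  qed
  moreover have "nat_isomorphic (fib (MM D) Y) (BB1 D) (Colim D X \<odot> sub (MM D) f) (Colim D Y)" if "initial D f"
    unfolding Colim_def cmp_ftor_assoc
  proof (rule coend_transport[OF f iY iX cell])
    fix b m assume b: "b \<in> Ob (BB1 D)" and m: "m \<in> Ob (fib (MM D) Y)"
    \<comment> \<open>Initial maps control arrows from \<open>i m\<close> to \<open>i' n\<close>, so
      the constant target of a cocone is now presented as \<open>i' n\<close>.\<close>
    obtain n where n: "n \<in> Ob (fib (MM' D) Y)" "isomorphic (fib (PP D) Y) (fo (fn (ii' D) Y) n) (fo (const D Y) b)"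
      using const_in_image(2)[OF O(2) b] by blast
    show "bij_at (fib (PP D) Y) (fib (PP D) X) (sub (PP D) f) (fo (fn (ii D) Y) m) (fo (const D Y) b)"
      by (rule S.bij_at_isomorphic[OF initial_bij_at[OF f that m n(1)] refl(1)[OF m] n(2)])
  qed
  moreover have "nat_isomorphic (fib (MM' D) Y) (BB1 D) (Lim' D X \<odot> sub (MM' D) f) (Lim' D Y)" if "initial D f"
    unfolding Lim'_def cmp_ftor_assoc
  proof (rule end_transport[OF f i'Y i'X cell'])
    fix b n assume b: "b \<in> Ob (BB1 D)" and n: "n \<in> Ob (fib (MM' D) Y)"
    \<comment> \<open>The constant source of a cone over \<open>i' n\<close> is presented as
      \<open>i m\<close>.\<close>
    obtain m where m: "m \<in> Ob (fib (MM D) Y)" "isomorphic (fib (PP D) Y) (fo (fn (ii D) Y) m) (fo (const D Y) b)"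
      using const_in_image(1)[OF O(2) b] by blast
    show "bij_at (fib (PP D) Y) (fib (PP D) X) (sub (PP D) f) (fo (const D Y) b) (fo (fn (ii' D) Y) n)"
      by (rule S.bij_at_isomorphic[OF initial_bij_at[OF f that m(1) n] m(2) refl(2)[OF n]])
  qed
  ultimately show ?thesis by blast
qed

end
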